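(* Let $p\in(3/4,1)$ and let $W_1$ be the real random variable defined in the context. Denote $r_n:=\mathbb{E}W_1^n$ for $n\ge 0$ and $C_n^m:=\frac{n!}{m!(n-m)!}$. Then $r_1=1$ and: (i) for every odd $n\ge1$, $$[(n+1)(2p-1)-1]\,r_{n+1}=2\sum_{i=1}^{\frac{n-1}2}C_n^{2i-1}r_{2i}\,r_{n+1-2i}+2(2p-1)\sum_{i=1}^{\frac{n+1}2}C_n^{2i-1}r_{2i-1}\,r_{n+2-2i};$$ (ii) for every even $n\ge1$, $$n(2p-1)\,r_{n+1}=2p\sum_{i=1}^{\frac n2}\left(C_n^{2i-1}+C_n^{2i}\right)r_{2i}\,r_{n+1-2i}.$$
   Context: Consider an urn containing balls of two types, $+1$ and $-1$. At time $0$ it contains exactly one ball, of type $+1$. Each ball present is equipped with an $\mathrm{Exp}(1)$-distributed random clock, all clocks being independent. When the clock of a ball rings, one adds to the urn a new ball, which has the same type as that ball with probability $p$ and the opposite type with probability $1-p$; the clock that rang is replaced by a new independent $\mathrm{Exp}(1)$ clock, and the added ball receives its own independent $\mathrm{Exp}(1)$ clock. Let $U_t(1)$ and $U_t(-1)$ be the numbers of balls of type $+1$ and $-1$ at time $t\ge0$. It is known that for $p>3/4$ the limit $$W_1:=\lim_{t\to\infty}\frac{U_t(1)-U_t(-1)}{e^{(2p-1)t}}$$ exists almost surely, $W_1\in L^r$ for every $r\ge1$, and $\mathbb{E}W_1=1$. Empty sums are $0$. *)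

theory Defs
  imports "HOL-Probability.Probability"
begin

text \<open>
  Balls are labelled by their genealogy: \<open>[]\<close> is the ball present at time 0, and \<open>k # u\<close> is the
  ball added when the clock of ball \<open>u\<close> rings for the \<open>k\<close>-th time (counting from 0).
  \<open>clock (u, k)\<close> is the running time of the \<open>k\<close>-th clock carried by ball \<open>u\<close>, and
  \<open>mark (u, k)\<close> is \<open>1\<close> or \<open>-1\<close> according to whether the ball added when that clock rings has
  the type of \<open>u\<close> or the opposite type.
\<close>

locale two_type_urn = prob_space M for M :: "'w measure" +
  fixes p :: real
    and clock :: "nat list \<times> nat \<Rightarrow> 'w \<Rightarrow> real"
    and mark :: "nat list \<times> nat \<Rightarrow> 'w \<Rightarrow> real"
  assumes clock_exponential: "distributed M lborel (clock i) (exponential_density 1)"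
    and mark_same: "prob {\<omega> \<in> space M. mark i \<omega> = 1} = p"
    and mark_opposite: "prob {\<omega> \<in> space M. mark i \<omega> = -1} = 1 - p"
    \<comment> \<open>joint independence of all clocks and all marks together\<close>
    and independent: "indep_vars (\<lambda>_. borel) (case_sum clock mark) UNIV"

primrec birth_time :: "(nat list \<times> nat \<Rightarrow> 'w \<Rightarrow> real) \<Rightarrow> 'w \<Rightarrow> nat list \<Rightarrow> real" where
  "birth_time clock \<omega> [] = 0"
| "birth_time clock \<omega> (k # u) = birth_time clock \<omega> u + (\<Sum>j\<le>k. clock (u, j) \<omega>)"

primrec ball_type :: "(nat list \<times> nat \<Rightarrow> 'w \<Rightarrow> real) \<Rightarrow> 'w \<Rightarrow> nat list \<Rightarrow> real" where
  "ball_type mark \<omega> [] = 1"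
| "ball_type mark \<omega> (k # u) = mark (u, k) \<omega> * ball_type mark \<omega> u"

text \<open>
  The number of balls of type \<open>\<sigma>\<close> at time \<open>t\<close>. Almost surely only finitely many balls are
  present at any time, so the convention that infinite sets have cardinality 0 only matters
  on a null set.
\<close>

definition urn_count ::
  "(nat list \<times> nat \<Rightarrow> 'w \<Rightarrow> real) \<Rightarrow> (nat list \<times> nat \<Rightarrow> 'w \<Rightarrow> real) \<Rightarrow> 'w \<Rightarrow> real \<Rightarrow> real \<Rightarrow> nat" where
  "urn_count clock mark \<omega> t \<sigma> =
     card {u. birth_time clock \<omega> u \<le> t \<and> ball_type mark \<omega> u = \<sigma>}"

end

theory Submission
  imports Defs
begin

text \<open>
  Put \<open>s = 2 p - 1\<close> and let \<open>\<tau>\<close> be the time of the first ring. From \<open>\<tau>\<close> on the urn is the superposition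
  of two independent urns of the same kind, one founded by the initial ball, the other by its first
  child, and the types in the latter are multiplied by a random sign \<open>\<xi>\<close> of mean \<open>s\<close>. In the limit this
  gives \<open>W = exp (- s \<tau>) (W' + \<xi> W'')\<close> with independent \<open>\<tau>\<close>, \<open>\<xi>\<close>, \<open>W'\<close>, \<open>W''\<close>. Taking \<open>n\<close>-th moments and using
  \<open>E exp (- n s \<tau>) = 1 / (1 + n s)\<close> one obtains
  \<open>(1 + n s) r n = (\<Sum>j\<le>n. (n choose j) * E (\<xi> ^ j) * r j * r (n - j))\<close>. Moving the terms \<open>j = 0\<close> and \<open>j = n\<close>
  to the left and folding the rest by the symmetry \<open>j \<mapsto> n - j\<close> yields the two identities
  (\<open>branching_recursion_odd_index\<close>, \<open>branching_recursion_even_index\<close>).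

  To have finite sums throughout, the decomposition is carried out before the limit, for differences of
  counts at a fixed time, truncated to labels of bounded depth (\<open>scaled_difference_Suc\<close>). Their moments
  satisfy a renewal recursion in the depth (\<open>expectation_scaled_difference_power\<close>); it determines the
  moments for all urns with parameter \<open>p\<close> at once, in particular for both sub-urns. The recursion
  bounds all moments uniformly in depth and time, because
  \<open>2 / (1 + n s) < 1\<close> for \<open>n \<ge> 2\<close> as soon as \<open>s > 1/2\<close> (\<open>truncated_moment_bounded\<close>); it also forces the first
  moment to converge to \<open>1\<close> as the depth grows (\<open>truncated_moment_n1\<close>). Bounds on the moments of order
  \<open>2 n\<close> make those of order \<open>n\<close> converge along with the variables (\<open>expectation_tendsto_of_second_moments\<close>).
  Letting first the depth and then the time tend to infinity in the renewal recursion gives the moment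
  identity (\<open>limit_moments\<close>).

  The depth truncation can be removed because almost surely only finitely many balls are present at
  any time: summing \<open>exp (- 2 b)\<close> over the birth times \<open>b\<close> of all labels gives a finite expectation
  (\<open>expectation_birth_weight_le\<close>).
\<close>

section \<open>Genealogy after the first ring\<close>

text \<open>
  The number of clock rings that separate the birth of a ball from time \<open>0\<close>: along the ancestral line,
  ball \<open>k # u\<close> is added at ring number \<open>k + 1\<close> of its parent.
\<close>

primrec depth :: "nat list \<Rightarrow> nat" where
  "depth [] = 0"
| "depth (k # u) = Suc k + depth u"

text \<open>
  After the first ring of the initial ball, that ball starts afresh, except that what would be
  the child number \<open>k\<close> of the restarted ball has number \<open>k + 1\<close> in the original genealogy. The
  oldest ancestor stands at the end of a label, so the shift concerns the last entry.
\<close>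

primrec delay :: "nat list \<Rightarrow> nat list" where
  "delay [] = []"
| "delay (k # u) = (if u = [] then [Suc k] else k # delay u)"

text \<open>
  Selecting the clocks and marks at these positions gives the urn founded by the first child
  (\<open>child_index\<close>) and the urn of the restarted initial ball (\<open>root_index\<close>). The restarted ball
  has already used its clock number \<open>0\<close>.
\<close>

fun child_index :: "nat list \<times> nat \<Rightarrow> nat list \<times> nat" where
  "child_index (u, k) = (u @ [0], k)"

fun root_index :: "nat list \<times> nat \<Rightarrow> nat list \<times> nat" where
  "root_index (u, k) = (delay u, if u = [] then Suc k else k)"

definition labels :: "nat \<Rightarrow> nat list set" where
  "labels k = {u. depth u \<le> k}"

lemma delay_eq_Nil_iff [simp]: "delay u = [] \<longleftrightarrow> u = []"
  by (cases u) auto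

lemma Nil_eq_delay_iff [simp]: "[] = delay u \<longleftrightarrow> u = []"
  by (cases u) auto

lemma delay_neq_append_zero: "delay u \<noteq> v @ [0]"
  by (induction u arbitrary: v) (auto simp: Cons_eq_append_conv)

lemma inj_delay: "inj delay"
proof (rule injI)
  show "u = v" if "delay u = delay v" for u v
    using that
  proof (induction u arbitrary: v)
    case Nil
    then show ?case
      by (metis delay.simps(1) delay_eq_Nil_iff)
  next
    case (Cons k u)
    then obtain l v' where "v = l # v'"
      by (metis delay_eq_Nil_iff list.exhaust)
    with Cons show ?case
      by (auto split: if_splits dest: sym)
  qed
qed

lemma depth_child: "depth (u @ [0]) = Suc (depth u)"
  by (induction u) auto

lemma depth_delay: "depth (delay u) = (if u = [] then 0 else Suc (depth u))"
  by (induction u) auto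

text \<open>
  This is the branching decomposition on the level of labels: a ball either descends from the first
  child or belongs to the restarted initial ball, and the two alternatives exclude each other by
  \<open>delay_neq_append_zero\<close>.
\<close>

lemma label_cases: "u = [] \<or> (\<exists>v. u = v @ [0]) \<or> (\<exists>v. v \<noteq> [] \<and> u = delay v)"
proof (induction u)
  case (Cons k u)
  show ?case
  proof (cases u)
    case Nil
    have "k # u = [] @ [0]" if "k = 0"
      using that Nil by simp
    moreover have "k # u = delay [k - 1]" if "k \<noteq> 0"
      using that Nil by simp
    ultimately show ?thesis
      by blast
  next
    case (Cons l w)
    with Cons.IH consider v where "u = v @ [0]" | v where "v \<noteq> []" "u = delay v"
      by blast
    then show ?thesis
    proof cases
      case (1 v)
      then have "k # u = (k # v) @ [0]" by simp
      then show ?thesis by blast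
    next
      case (2 v)
      then have "k # u = delay (k # v)" by simp
      then show ?thesis by blast
    qed
  qed
qed simp

lemma labels_0 [simp]: "labels 0 = {[]}"
proof -
  have "u = []" if "depth u = 0" for u
    using that by (cases u) auto
  then show ?thesis
    by (auto simp: labels_def)
qed

lemma labels_Suc: "labels (Suc k) = (\<lambda>u. u @ [0]) ` labels k \<union> delay ` labels k"
proof (intro equalityI subsetI)
  fix u assume "u \<in> labels (Suc k)"
  then have *: "depth u \<le> Suc k"
    by (simp add: labels_def)
  consider "u = []" | v where "u = v @ [0]" | v where "v \<noteq> []" "u = delay v"
    using label_cases[of u] by blast
  then show "u \<in> (\<lambda>u. u @ [0]) ` labels k \<union> delay ` labels k"
  proof cases
    case 1
    have "[] = delay []" "[] \<in> labels k"
      by (auto simp: labels_def)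
    with 1 show ?thesis by blast
  next
    case (2 v)
    then show ?thesis
      using * by (auto simp: labels_def depth_child)
  next
    case (3 v)
    then show ?thesis
      using * by (auto simp: labels_def depth_delay)
  qed
qed (auto simp: labels_def depth_child depth_delay)

lemma finite_labels [simp]: "finite (labels k)"
  by (induction k) (auto simp: labels_Suc)

lemma mono_labels: "k \<le> l \<Longrightarrow> labels k \<subseteq> labels l"
  by (auto simp: labels_def)

lemma Nil_in_labels [simp]: "[] \<in> labels k"
  by (simp add: labels_def)

lemma sum_labels_Suc:
  fixes f :: "nat list \<Rightarrow> 'a :: comm_monoid_add"
  shows "(\<Sum>u\<in>labels (Suc k). f u) = (\<Sum>u\<in>labels k. f (u @ [0])) + (\<Sum>u\<in>labels k. f (delay u))"
proof -
  have "(\<Sum>u\<in>labels (Suc k). f u) = (\<Sum>u\<in>(\<lambda>u. u @ [0]) ` labels k. f u) + (\<Sum>u\<in>delay ` labels k. f u)"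
    unfolding labels_Suc by (rule sum.union_disjoint) (auto simp: delay_neq_append_zero[symmetric])
  then show ?thesis
    by (simp add: sum.reindex inj_on_def injD[OF inj_delay])
qed

lemma birth_time_child:
  "birth_time clock \<omega> (u @ [0]) = clock ([], 0) \<omega> + birth_time (clock \<circ> child_index) \<omega> u"
  by (induction u) auto

lemma birth_time_delay:
  assumes "u \<noteq> []"
  shows "birth_time clock \<omega> (delay u) = clock ([], 0) \<omega> + birth_time (clock \<circ> root_index) \<omega> u"
  using assms
proof (induction u)
  case (Cons k u)
  show ?case
  proof (cases "u = []")
    case True
    then show ?thesis
      by (simp add: sum.atMost_Suc_shift del: sum.atMost_Suc)
  qed (use Cons.IH in simp)
qed simp

lemma ball_type_child:
  "ball_type mark \<omega> (u @ [0]) = mark ([], 0) \<omega> * ball_type (mark \<circ> child_index) \<omega> u"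
  by (induction u) auto

lemma ball_type_delay: "ball_type mark \<omega> (delay u) = ball_type (mark \<circ> root_index) \<omega> u"
  by (induction u) auto

text \<open>
  Cutting the genealogy at a finite depth turns the difference of the two counts into a finite sum.
  All its moments exist, and it is visibly measurable.
\<close>

definition scaled_difference ::
  "real \<Rightarrow> (nat list \<times> nat \<Rightarrow> 'w \<Rightarrow> real) \<Rightarrow> (nat list \<times> nat \<Rightarrow> 'w \<Rightarrow> real) \<Rightarrow> nat \<Rightarrow> real \<Rightarrow> 'w \<Rightarrow> real"
where
  "scaled_difference s clock mark k t \<omega> =
     exp (- s * t) * (\<Sum>u\<in>labels k. of_bool (birth_time clock \<omega> u \<le> t) * ball_type mark \<omega> u)"

lemma birth_time_nonneg:
  assumes "\<And>i. clock i \<omega> \<ge> 0"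
  shows "birth_time clock \<omega> u \<ge> 0"
  by (induction u) (auto intro!: add_nonneg_nonneg sum_nonneg assms)

lemma scaled_difference_0:
  "t \<ge> 0 \<Longrightarrow> scaled_difference s clock mark 0 t \<omega> = exp (- s * t)"
  by (simp add: scaled_difference_def)

text \<open>
  Before the first ring only the initial ball is present. Afterwards the two sub-urns run on the
  clock shifted by \<open>\<tau>\<close>; the types in the urn of the first child are multiplied by the mark
  of that ring. Each of the two sub-urns loses one level of depth, which makes induction on the
  depth possible.
\<close>

lemma scaled_difference_Suc:
  assumes nonneg: "\<And>i. clock i \<omega> \<ge> 0" and t: "t \<ge> 0"
  defines "\<tau> \<equiv> clock ([], 0) \<omega>"
  shows "scaled_difference s clock mark (Suc k) t \<omega> =
    (if t < \<tau> then exp (- s * t)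
     else exp (- s * \<tau>) *
       (scaled_difference s (clock \<circ> root_index) (mark \<circ> root_index) k (t - \<tau>) \<omega>
        + mark ([], 0) \<omega> *
          scaled_difference s (clock \<circ> child_index) (mark \<circ> child_index) k (t - \<tau>) \<omega>))"
proof -
  let ?birth = "birth_time clock \<omega>"
  let ?br = "birth_time (clock \<circ> root_index) \<omega>" and ?Tr = "ball_type (mark \<circ> root_index) \<omega>"
  let ?bc = "birth_time (clock \<circ> child_index) \<omega>" and ?Tc = "ball_type (mark \<circ> child_index) \<omega>"
  have pos: "?br u \<ge> 0" "?bc u \<ge> 0" for u
    using nonneg by (auto intro!: birth_time_nonneg)
  have split: "scaled_difference s clock mark (Suc k) t \<omega> = exp (- s * t) *
     ((\<Sum>u\<in>labels k. of_bool (\<tau> + ?bc u \<le> t) * (mark ([], 0) \<omega> * ?Tc u))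
      + (\<Sum>u\<in>labels k. of_bool (?birth (delay u) \<le> t) * ?Tr u))"
    by (simp add: scaled_difference_def sum_labels_Suc birth_time_child ball_type_child
        ball_type_delay \<tau>_def)
  show ?thesis
  proof (cases "t < \<tau>")
    case True
    have "\<not> \<tau> + ?bc u \<le> t" for u
      using True pos(2)[of u] by linarith
    moreover have "?birth (delay u) \<le> t \<longleftrightarrow> u = []" for u
      using True pos(1)[of u] t by (cases "u = []") (auto simp: birth_time_delay simp flip: \<tau>_def)
    moreover have "(\<Sum>u\<in>labels k. of_bool (u = []) * ?Tr u) = (\<Sum>u\<in>labels k. if u = [] then 1 else 0)"
      by (intro sum.cong) auto
    ultimately show ?thesis
      using True by (simp add: split)
  next
    case False
    have "(?birth (delay u) \<le> t) = (?br u \<le> t - \<tau>)" for u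
      using False t by (cases "u = []") (auto simp: birth_time_delay algebra_simps simp flip: \<tau>_def)
    moreover have "\<tau> + ?bc u \<le> t \<longleftrightarrow> ?bc u \<le> t - \<tau>" for u
      by auto
    moreover have "exp (- s * t) = exp (- s * \<tau>) * exp (- s * (t - \<tau>))"
      by (simp add: algebra_simps flip: exp_add)
    ultimately have "scaled_difference s clock mark (Suc k) t \<omega> =
        exp (- s * \<tau>) * exp (- s * (t - \<tau>)) *
         ((\<Sum>u\<in>labels k. of_bool (?bc u \<le> t - \<tau>) * (mark ([], 0) \<omega> * ?Tc u))
          + (\<Sum>u\<in>labels k. of_bool (?br u \<le> t - \<tau>) * ?Tr u))"
      unfolding split by presburger
    then show ?thesis
      using False
      by (simp add: scaled_difference_def sum_distrib_left distrib_left mult_ac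
          del: sum_of_bool_mult_eq sum_mult_of_bool_eq)
  qed
qed

lemma measurable_birth_time [measurable]:
  assumes [measurable]: "\<And>i. clock i \<in> borel_measurable N"
  shows "(\<lambda>\<omega>. birth_time clock \<omega> u) \<in> borel_measurable N"
  by (induction u) auto

lemma measurable_ball_type [measurable]:
  assumes [measurable]: "\<And>i. mark i \<in> borel_measurable N"
  shows "(\<lambda>\<omega>. ball_type mark \<omega> u) \<in> borel_measurable N"
  by (induction u) auto

lemma measurable_scaled_difference:
  assumes [measurable]: "\<And>i. clock i \<in> borel_measurable N" "\<And>i. mark i \<in> borel_measurable N"
    "T \<in> borel_measurable N"
  shows "(\<lambda>\<omega>. scaled_difference s clock mark k (T \<omega>) \<omega>) \<in> borel_measurable N"
  unfolding scaled_difference_def by measurable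

lemma inj_child_index: "inj child_index"
  by (auto simp: inj_def)

lemma inj_root_index: "inj root_index"
  by (auto simp: inj_def dest: injD[OF inj_delay] split: if_splits)

section \<open>Moments of the depth-truncated urn\<close>

text \<open>
  The \<open>n\<close>-th moment of \<open>X + \<xi> Y\<close>, where \<open>X\<close> and \<open>Y\<close> have moments \<open>b\<close>, \<open>\<xi>\<close> is a sign with mean \<open>s\<close>,
  and the three are independent.
\<close>

definition branching_form :: "real \<Rightarrow> (nat \<Rightarrow> real) \<Rightarrow> nat \<Rightarrow> real" where
  "branching_form s b n =
     (\<Sum>j\<le>n. real (n choose j) * (if even j then 1 else s) * b j * b (n - j))"

text \<open>
  Conditioning the truncated difference on the first ring time \<open>x\<close> yields this renewal recursion. The
  density \<open>exp (- x)\<close> and the normalising factor \<open>exp (- n s x)\<close> combine to the weight \<open>exp (- (1 + n s) x)\<close>.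
  It involves the urn only through \<open>s\<close>, so an urn and its sub-urns share their truncated moments.
\<close>

primrec truncated_moment :: "real \<Rightarrow> nat \<Rightarrow> nat \<Rightarrow> real \<Rightarrow> real" where
  "truncated_moment s 0 n t = exp (- (real n * s) * t)"
| "truncated_moment s (Suc k) n t = exp (- (1 + real n * s) * t) +
     (\<integral>x. (if 0 \<le> x \<and> x \<le> t
           then exp (- (1 + real n * s) * x) * branching_form s (\<lambda>j. truncated_moment s k j (t - x)) n
           else 0) \<partial>lborel)"

lemma measurable_truncated_moment [measurable]: "truncated_moment s k n \<in> borel_measurable borel"
proof (induction k arbitrary: n)
  case 0
  show ?case
    unfolding truncated_moment.simps(1)[abs_def] by measurable
next
  case (Suc k)
  note [measurable] = Suc.IH
  show ?case
    unfolding truncated_moment.simps(2)[abs_def] branching_form_def by measurable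
qed

lemma (in prob_space) indep_vars_reindex:
  assumes indep: "indep_vars (\<lambda>_. N) X UNIV" and "inj h"
  shows "indep_vars (\<lambda>_. N) (\<lambda>i. X (h i)) UNIV"
proof -
  have "indep_vars (\<lambda>j. PiM {h j} (\<lambda>_. N)) (\<lambda>j \<omega>. restrict (\<lambda>i. X i \<omega>) {h j}) UNIV"
    using \<open>inj h\<close> by (intro indep_vars_restrict[OF indep]) (auto simp: disjoint_family_on_def inj_def)
  then have "indep_vars (\<lambda>_. N) (\<lambda>j. (\<lambda>y. y (h j)) \<circ> (\<lambda>\<omega>. restrict (\<lambda>i. X i \<omega>) {h j})) UNIV"
    by (rule indep_vars_compose) auto
  then show ?thesis
    by (simp add: comp_def)
qed

lemma (in prob_space) indep_var_coordinates:
  assumes indep: "indep_vars (\<lambda>_. borel) X UNIV" and "A \<inter> B = {}"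
    and F: "F \<in> borel_measurable (PiM A (\<lambda>_. borel))"
    and G: "G \<in> borel_measurable (PiM B (\<lambda>_. borel))"
  shows "indep_var borel (\<lambda>\<omega>. F (restrict (\<lambda>i. X i \<omega>) A)) borel (\<lambda>\<omega>. G (restrict (\<lambda>i. X i \<omega>) B))"
  using indep_var_compose[OF indep_var_restrict[OF indep \<open>A \<inter> B = {}\<close>] F G] by (simp add: comp_def)

text \<open>
  Independence of two variables is defined for a common value type. A single real coordinate is
  therefore first treated as an element of the product over a singleton index set, and then projected.
\<close>

lemma (in prob_space) joint_distribution_coordinate:
  fixes X :: "'i \<Rightarrow> 'a \<Rightarrow> real"
  assumes indep: "indep_vars (\<lambda>_. borel) X UNIV" and "i \<notin> B"
  shows "distr M borel (X i) \<Otimes>\<^sub>M distr M (PiM B (\<lambda>_. borel)) (\<lambda>\<omega>. restrict (\<lambda>i. X i \<omega>) B) =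
    distr M (borel \<Otimes>\<^sub>M PiM B (\<lambda>_. borel)) (\<lambda>\<omega>. (X i \<omega>, restrict (\<lambda>i. X i \<omega>) B))"
proof -
  let ?I = "PiM {i} (\<lambda>_. borel :: real measure)" and ?B = "PiM B (\<lambda>_. borel :: real measure)"
  let ?X = "\<lambda>A \<omega>. restrict (\<lambda>i. X i \<omega>) A"
  have [measurable]: "random_variable borel (X j)" for j
    using indep by (auto simp: indep_vars_def)
  have iv: "indep_var ?I (?X {i}) ?B (?X B)"
    using \<open>i \<notin> B\<close> by (intro indep_var_restrict[OF indep]) auto
  then have joint: "distr M ?I (?X {i}) \<Otimes>\<^sub>M distr M ?B (?X B) = distr M (?I \<Otimes>\<^sub>M ?B) (\<lambda>\<omega>. (?X {i} \<omega>, ?X B \<omega>))"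
    by (simp add: indep_var_distribution_eq)
  interpret B: prob_space "distr M ?B (?X B)" by (rule prob_space_distr) simp
  have "distr M borel (X i) \<Otimes>\<^sub>M distr M ?B (?X B) =
      distr (distr M ?I (?X {i})) borel (\<lambda>y. y i) \<Otimes>\<^sub>M distr (distr M ?B (?X B)) ?B (\<lambda>y. y)"
    by (simp add: distr_distr comp_def)
  also have "\<dots> = distr (distr M ?I (?X {i}) \<Otimes>\<^sub>M distr M ?B (?X B)) (borel \<Otimes>\<^sub>M ?B) (\<lambda>(x, y). (x i, y))"
    by (intro pair_measure_distr) (auto simp: distr_distr comp_def B.sigma_finite_measure_axioms)
  also have "\<dots> = distr M (borel \<Otimes>\<^sub>M ?B) (\<lambda>\<omega>. (X i \<omega>, ?X B \<omega>))"
    unfolding joint by (simp add: distr_distr comp_def)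
  finally show ?thesis .
qed

text \<open>
  Integrate first over \<open>Y\<close> with \<open>U\<close> frozen at \<open>x\<close>, then over \<open>x\<close>. Integrability is assumed along the
  actual pair \<open>(U, Y)\<close>: functionals of the marks are bounded only where all marks are signs, and
  that is an almost sure event.
\<close>

lemma (in prob_space) expectation_freeze:
  fixes F :: "real \<times> 'c \<Rightarrow> real" and N :: "'c measure"
  assumes [measurable]: "random_variable borel U" "random_variable N Y"
    and joint: "distr M borel U \<Otimes>\<^sub>M distr M N Y = distr M (borel \<Otimes>\<^sub>M N) (\<lambda>\<omega>. (U \<omega>, Y \<omega>))"
    and U: "distributed M lborel U (exponential_density 1)"
    and F[measurable]: "F \<in> borel_measurable (borel \<Otimes>\<^sub>M N)"
    and int: "integrable M (\<lambda>\<omega>. F (U \<omega>, Y \<omega>))"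
  shows "integrable lborel (\<lambda>x. exponential_density 1 x * expectation (\<lambda>\<omega>. F (x, Y \<omega>)))"
    and "expectation (\<lambda>\<omega>. F (U \<omega>, Y \<omega>)) =
      (\<integral>x. exponential_density 1 x * expectation (\<lambda>\<omega>. F (x, Y \<omega>)) \<partial>lborel)"
proof -
  let ?D = "density lborel (exponential_density 1)"
  have dU: "distr M borel U = ?D"
    using distributed_distr_eq_density[OF U] by (simp cong: distr_cong)
  interpret U: prob_space "distr M borel U" by (rule prob_space_distr) simp
  interpret Y: prob_space "distr M N Y" by (rule prob_space_distr) simp
  interpret UY: pair_prob_space "distr M borel U" "distr M N Y" ..
  have intF: "integrable (distr M borel U \<Otimes>\<^sub>M distr M N Y) F"
    unfolding joint using int by (subst integrable_distr_eq) auto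
  have inner: "(\<integral>y. F (x, y) \<partial>distr M N Y) = expectation (\<lambda>\<omega>. F (x, Y \<omega>))" for x
    by (subst integral_distr) auto
  have [measurable]: "(\<lambda>x. expectation (\<lambda>\<omega>. F (x, Y \<omega>))) \<in> borel_measurable borel"
    by measurable
  have "integrable ?D (\<lambda>x. expectation (\<lambda>\<omega>. F (x, Y \<omega>)))"
    using UY.integrable_fst'[OF intF] by (simp add: inner dU)
  then show "integrable lborel (\<lambda>x. exponential_density 1 x * expectation (\<lambda>\<omega>. F (x, Y \<omega>)))"
    by (subst (asm) integrable_density) (auto simp: exponential_density_nonneg)
  have "expectation (\<lambda>\<omega>. F (U \<omega>, Y \<omega>)) = (\<integral>z. F z \<partial>(distr M borel U \<Otimes>\<^sub>M distr M N Y))"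
    unfolding joint by (subst integral_distr) auto
  also have "\<dots> = (\<integral>x. expectation (\<lambda>\<omega>. F (x, Y \<omega>)) \<partial>?D)"
    using UY.integral_fst'[OF intF] by (simp add: inner dU)
  also have "\<dots> = (\<integral>x. exponential_density 1 x * expectation (\<lambda>\<omega>. F (x, Y \<omega>)) \<partial>lborel)"
    by (subst integral_density) (auto simp: exponential_density_nonneg)
  finally show "expectation (\<lambda>\<omega>. F (U \<omega>, Y \<omega>)) =
      (\<integral>x. exponential_density 1 x * expectation (\<lambda>\<omega>. F (x, Y \<omega>)) \<partial>lborel)" .
qed

lemma scaled_difference_cong:
  assumes "\<And>i. clock i \<omega> = clock' i \<omega>'" "\<And>i. mark i \<omega> = mark' i \<omega>'"
  shows "scaled_difference s clock mark k t \<omega> = scaled_difference s clock' mark' k t \<omega>'"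
proof -
  have "birth_time clock \<omega> u = birth_time clock' \<omega>' u" for u
    by (induction u) (simp_all add: assms)
  moreover have "ball_type mark \<omega> u = ball_type mark' \<omega>' u" for u
    by (induction u) (simp_all add: assms)
  ultimately show ?thesis
    by (simp add: scaled_difference_def)
qed

lemma ball_type_sign:
  assumes "\<And>i. mark i \<omega> \<in> {1, -1}"
  shows "ball_type mark \<omega> u \<in> {1, -1}"
proof (induction u)
  case (Cons k u)
  then show ?case
    using assms[of "(u, k)"] by auto
qed simp

lemma abs_scaled_difference_le:
  assumes "\<And>i. mark i \<omega> \<in> {1, -1}" "s \<ge> 0" "t \<ge> 0"
  shows "\<bar>scaled_difference s clock mark k t \<omega>\<bar> \<le> card (labels k)"
proof -
  have "\<bar>of_bool (birth_time clock \<omega> u \<le> t) * ball_type mark \<omega> u\<bar> \<le> 1" for u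
    using ball_type_sign[of mark \<omega> u] assms(1) by auto
  then have "\<bar>\<Sum>u\<in>labels k. of_bool (birth_time clock \<omega> u \<le> t) * ball_type mark \<omega> u\<bar> \<le> (\<Sum>u\<in>labels k. 1)"
    by (intro order_trans[OF sum_abs] sum_mono)
  moreover have "exp (- s * t) \<le> 1"
    using assms by simp
  ultimately show ?thesis
    unfolding scaled_difference_def abs_mult
    using mult_mono[of "exp (- s * t)" 1] by simp
qed

context two_type_urn
begin

abbreviation "noise \<equiv> case_sum clock mark"

lemma measurable_noise [measurable]: "noise i \<in> borel_measurable M"
  using independent by (auto simp: indep_vars_def)

lemma measurable_clock [measurable]: "clock i \<in> borel_measurable M"
  using measurable_noise[of "Inl i"] by simp

lemma measurable_mark [measurable]: "mark i \<in> borel_measurable M"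
  using measurable_noise[of "Inr i"] by simp

text \<open>
  Both sub-urns live on the same probability space and satisfy the same axioms, so every statement
  proved for all urns applies to them.
\<close>

lemma subfamily:
  assumes "inj h"
  shows "two_type_urn M p (clock \<circ> h) (mark \<circ> h)"
proof -
  have "indep_vars (\<lambda>_. borel) (\<lambda>i. noise (map_sum h h i)) UNIV"
    using \<open>inj h\<close> by (intro indep_vars_reindex[OF independent] sum.inj_map)
  moreover have "(\<lambda>i. noise (map_sum h h i)) = case_sum (clock \<circ> h) (mark \<circ> h)"
    by (auto simp: fun_eq_iff split: sum.split)
  ultimately show ?thesis
    by unfold_locales (simp_all add: clock_exponential mark_same mark_opposite)
qed

lemma AE_clock_nonneg: "AE \<omega> in M. \<forall>i. clock i \<omega> \<ge> 0"
proof -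
  have "AE \<omega> in M. clock i \<omega> \<ge> 0" for i
    using clock_exponential[of i]
    by (subst distributed_AE2[OF clock_exponential]) (auto simp: exponential_density_def)
  then show ?thesis
    by (simp add: AE_all_countable)
qed

lemma AE_mark: "AE \<omega> in M. \<forall>i. mark i \<omega> \<in> {1, -1}"
proof -
  have "AE \<omega> in M. mark i \<omega> \<in> {1, -1}" for i
  proof -
    have "prob ({\<omega> \<in> space M. mark i \<omega> = 1} \<union> {\<omega> \<in> space M. mark i \<omega> = - 1}) = 1"
      by (subst finite_measure_Union) (auto simp: mark_same mark_opposite)
    from prob_eq_1[THEN iffD1, OF _ this] show ?thesis
      by (auto elim: eventually_mono)
  qed
  then show ?thesis
    by (simp add: AE_all_countable)
qed

lemma expectation_mark_power:
  "expectation (\<lambda>\<omega>. mark i \<omega> ^ j) = (if even j then 1 else 2 * p - 1)"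
proof -
  let ?A = "{\<omega> \<in> space M. mark i \<omega> = 1}"
  have sign: "AE \<omega> in M. mark i \<omega> = 1 \<or> mark i \<omega> = - 1"
    using AE_mark by eventually_elim blast
  show ?thesis
  proof (cases "even j")
    case True
    have "expectation (\<lambda>\<omega>. mark i \<omega> ^ j) = expectation (\<lambda>\<omega>. 1)"
      using sign True by (intro integral_cong_AE) (auto elim!: eventually_mono)
    then show ?thesis
      using True by (simp add: prob_space)
  next
    case False
    have "AE \<omega> in M. mark i \<omega> ^ j = 2 * indicator ?A \<omega> - 1"
      using sign AE_space by eventually_elim (use False in auto)
    then have "expectation (\<lambda>\<omega>. mark i \<omega> ^ j) = expectation (\<lambda>\<omega>. 2 * indicator ?A \<omega> - 1)"
      by (intro integral_cong_AE) auto
    also have "\<dots> = 2 * p - 1"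
      using mark_same[of i]
      by (subst Bochner_Integration.integral_diff) (auto simp: prob_space less_top[symmetric])
    finally show ?thesis
      using False by simp
  qed
qed

lemma measurable_scaled_difference_urn [measurable]:
  "T \<in> borel_measurable M \<Longrightarrow> (\<lambda>\<omega>. scaled_difference s clock mark k (T \<omega>) \<omega>) \<in> borel_measurable M"
  by (rule measurable_scaled_difference) auto

lemma integrable_scaled_difference_power:
  assumes "s \<ge> 0" "t \<ge> 0"
  shows "integrable M (\<lambda>\<omega>. scaled_difference s clock mark k t \<omega> ^ n)"
proof (rule integrable_const_bound)
  show "AE \<omega> in M. norm (scaled_difference s clock mark k t \<omega> ^ n) \<le> real (card (labels k)) ^ n"
    using AE_mark
    by eventually_elim (auto simp: power_abs intro!: power_mono abs_scaled_difference_le assms)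
qed measurable

end

text \<open>
  The truncated difference of the sub-urn selected by \<open>h\<close>, as a functional of a point in the product
  space of all clock and mark values. Independence of blocks of coordinates can be applied only to
  such functionals.
\<close>

definition coordinate_difference ::
  "real \<Rightarrow> (nat list \<times> nat \<Rightarrow> nat list \<times> nat) \<Rightarrow> nat \<Rightarrow> real \<Rightarrow> (nat list \<times> nat + nat list \<times> nat \<Rightarrow> real) \<Rightarrow> real"
where
  "coordinate_difference s h k t y =
     scaled_difference s (\<lambda>i y. y (Inl (h i))) (\<lambda>i y. y (Inr (h i))) k t y"

abbreviation coordinates where
  "coordinates h \<equiv> range (map_sum h h)"

lemma coordinate_mem: "Inl (h i) \<in> coordinates h" "Inr (h i) \<in> coordinates h"
  by (auto simp: image_iff intro: exI[of _ "Inl i"] exI[of _ "Inr i"])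

lemma measurable_coordinate_difference:
  assumes A: "coordinates h \<subseteq> A" and [measurable]: "T \<in> borel_measurable N"
    and [measurable]: "Y \<in> measurable N (PiM A (\<lambda>_. borel))"
  shows "(\<lambda>x. coordinate_difference s h k (T x) (Y x)) \<in> borel_measurable N"
proof -
  have [measurable]: "(\<lambda>x. Y x (Inl (h i))) \<in> borel_measurable N" for i
    using A coordinate_mem(1)[of h i]
    by (intro measurable_compose[OF _ measurable_component_singleton, of Y N A]) auto
  have [measurable]: "(\<lambda>x. Y x (Inr (h i))) \<in> borel_measurable N" for i
    using A coordinate_mem(2)[of h i]
    by (intro measurable_compose[OF _ measurable_component_singleton, of Y N A]) auto
  have "coordinate_difference s h k (T x) (Y x) =
      scaled_difference s (\<lambda>i x. Y x (Inl (h i))) (\<lambda>i x. Y x (Inr (h i))) k (T x) x" for x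
    unfolding coordinate_difference_def by (rule scaled_difference_cong) auto
  moreover have "(\<lambda>x. scaled_difference s (\<lambda>i x. Y x (Inl (h i))) (\<lambda>i x. Y x (Inr (h i))) k (T x) x)
      \<in> borel_measurable N"
    by (rule measurable_scaled_difference) auto
  ultimately show ?thesis
    by simp
qed

lemma child_neq_root_index: "child_index i \<noteq> root_index j"
  by (cases i; cases j) (auto simp: delay_neq_append_zero[symmetric])

lemma first_neq_child_index: "([], 0) \<noteq> child_index i"
  by (cases i) auto

lemma first_neq_root_index: "([], 0) \<noteq> root_index i"
  by (cases i) auto

lemma coordinates_disjoint: "coordinates child_index \<inter> coordinates root_index = {}"
proof -
  have "map_sum child_index child_index i \<noteq> map_sum root_index root_index j" for i j
    by (cases i; cases j) (auto simp: child_neq_root_index)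
  then show ?thesis
    by auto
qed

lemma first_notin_coordinates:
  "Inl ([], 0) \<notin> coordinates child_index" "Inr ([], 0) \<notin> coordinates child_index"
  "Inl ([], 0) \<notin> coordinates root_index" "Inr ([], 0) \<notin> coordinates root_index"
proof -
  have "Inl ([], 0) \<noteq> map_sum child_index child_index i" "Inr ([], 0) \<noteq> map_sum child_index child_index i"
    "Inl ([], 0) \<noteq> map_sum root_index root_index i" "Inr ([], 0) \<noteq> map_sum root_index root_index i" for i
    using first_neq_child_index first_neq_root_index by (cases i; auto)+
  then show "Inl ([], 0) \<notin> coordinates child_index" "Inr ([], 0) \<notin> coordinates child_index"
    "Inl ([], 0) \<notin> coordinates root_index" "Inr ([], 0) \<notin> coordinates root_index"
    by auto
qed

context two_type_urn
begin

lemma coordinate_difference_noise: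
  assumes "coordinates h \<subseteq> A"
  shows "coordinate_difference s h k t (restrict (\<lambda>i. noise i \<omega>) A) =
    scaled_difference s (clock \<circ> h) (mark \<circ> h) k t \<omega>"
  unfolding coordinate_difference_def
proof (rule scaled_difference_cong)
  have "Inl (h i) \<in> A" "Inr (h i) \<in> A" for i
    using assms coordinate_mem[of h i] by auto
  then show "restrict (\<lambda>i. noise i \<omega>) A (Inl (h i)) = (clock \<circ> h) i \<omega>"
    "restrict (\<lambda>i. noise i \<omega>) A (Inr (h i)) = (mark \<circ> h) i \<omega>" for i
    by auto
qed

text \<open>
  Expand \<open>(R + \<xi> C) ^ n\<close> by the binomial theorem. The mark \<open>\<xi>\<close>, the child urn \<open>C\<close> and the restarted
  urn \<open>R\<close> depend on pairwise disjoint sets of coordinates, so each mixed moment factorises.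
\<close>

lemma expectation_branch:
  assumes "s \<ge> 0" "t \<ge> 0" and s: "s = 2 * p - 1"
    and root: "\<And>j. expectation (\<lambda>\<omega>. scaled_difference s (clock \<circ> root_index) (mark \<circ> root_index) k t \<omega> ^ j) = b j"
    and child: "\<And>j. expectation (\<lambda>\<omega>. scaled_difference s (clock \<circ> child_index) (mark \<circ> child_index) k t \<omega> ^ j) = b j"
  shows "expectation (\<lambda>\<omega>. (scaled_difference s (clock \<circ> root_index) (mark \<circ> root_index) k t \<omega> +
      mark ([], 0) \<omega> * scaled_difference s (clock \<circ> child_index) (mark \<circ> child_index) k t \<omega>) ^ n)
    = branching_form s b n"
proof -
  interpret root: two_type_urn M p "clock \<circ> root_index" "mark \<circ> root_index"
    by (rule subfamily[OF inj_root_index])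
  interpret child: two_type_urn M p "clock \<circ> child_index" "mark \<circ> child_index"
    by (rule subfamily[OF inj_child_index])
  let ?R = "scaled_difference s (clock \<circ> root_index) (mark \<circ> root_index) k t"
  let ?C = "scaled_difference s (clock \<circ> child_index) (mark \<circ> child_index) k t"
  let ?m = "mark ([], 0)"
  let ?root = "coordinates root_index" and ?child = "coordinates child_index"
  let ?A = "insert (Inr ([], 0)) ?child"
  let ?noise = "\<lambda>A \<omega>. restrict (\<lambda>i. noise i \<omega>) A"
  have intR: "integrable M (\<lambda>\<omega>. ?R \<omega> ^ j)" for j
    by (rule root.integrable_scaled_difference_power[OF assms(1,2)])
  have intC: "integrable M (\<lambda>\<omega>. ?C \<omega> ^ j)" for j
    by (rule child.integrable_scaled_difference_power[OF assms(1,2)])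
  have intm: "integrable M (\<lambda>\<omega>. ?m \<omega> ^ j)" for j
    using AE_mark by (intro integrable_const_bound[of _ 1])
      (auto elim!: eventually_mono simp: power_abs dest!: spec[of _ "[]"] spec[of _ 0])
  have "indep_var borel (\<lambda>\<omega>. (?noise {Inr ([], 0)} \<omega> (Inr ([], 0))) ^ j)
      borel (\<lambda>\<omega>. (coordinate_difference s child_index k t (?noise ?child \<omega>)) ^ j)" for j
    using first_notin_coordinates
    by (intro indep_var_coordinates[OF independent] borel_measurable_power
        measurable_coordinate_difference[OF order_refl]) auto
  then have ivC: "indep_var borel (\<lambda>\<omega>. ?m \<omega> ^ j) borel (\<lambda>\<omega>. ?C \<omega> ^ j)" for j
    by (simp add: coordinate_difference_noise)
  have "indep_var borel (\<lambda>\<omega>. (?noise ?A \<omega> (Inr ([], 0))) ^ j * (coordinate_difference s child_index k t (?noise ?A \<omega>)) ^ j)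
      borel (\<lambda>\<omega>. (coordinate_difference s root_index k t (?noise ?root \<omega>)) ^ i)" for i j
    using first_notin_coordinates coordinates_disjoint
    by (intro indep_var_coordinates[OF independent] borel_measurable_power borel_measurable_times
        measurable_coordinate_difference[where h = root_index, OF order_refl]
        measurable_coordinate_difference[where h = child_index, OF subset_insertI[of _ "Inr ([], 0)"]]
        measurable_component_singleton) auto
  then have ivR: "indep_var borel (\<lambda>\<omega>. ?m \<omega> ^ j * ?C \<omega> ^ j) borel (\<lambda>\<omega>. ?R \<omega> ^ i)" for i j
    by (simp add: coordinate_difference_noise subset_insertI)
  have intmC: "integrable M (\<lambda>\<omega>. ?m \<omega> ^ j * ?C \<omega> ^ j)" for j
    by (rule indep_var_integrable[OF ivC intm intC])
  have term_int: "integrable M (\<lambda>\<omega>. ?m \<omega> ^ j * ?C \<omega> ^ j * ?R \<omega> ^ i)" for i j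
    by (rule indep_var_integrable[OF ivR intmC intR])
  have term_eq: "expectation (\<lambda>\<omega>. ?m \<omega> ^ j * ?C \<omega> ^ j * ?R \<omega> ^ i) = (if even j then 1 else s) * b j * b i" for i j
    by (simp add: indep_var_lebesgue_integral[OF ivR intmC intR] indep_var_lebesgue_integral[OF ivC intm intC]
        expectation_mark_power[folded s] root child)
  have "(?R \<omega> + ?m \<omega> * ?C \<omega>) ^ n = (\<Sum>j\<le>n. real (n choose j) * (?m \<omega> ^ j * ?C \<omega> ^ j * ?R \<omega> ^ (n - j)))" for \<omega>
    by (subst add.commute) (simp add: binomial_ring power_mult_distrib mult.assoc)
  then have "expectation (\<lambda>\<omega>. (?R \<omega> + ?m \<omega> * ?C \<omega>) ^ n) =
     (\<Sum>j\<le>n. real (n choose j) * ((if even j then 1 else s) * b j * b (n - j)))"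
    using term_int by (simp add: integral_sum term_eq)
  then show ?thesis
    by (simp add: branching_form_def mult.assoc)
qed

end

text \<open>
  The induction runs over the depth for all urns simultaneously. In the step, the first ring time is
  independent of all other clocks and marks, so it can be frozen at \<open>x\<close>; for \<open>x > t\<close> only the initial
  ball contributes, for \<open>x \<le> t\<close> the induction hypothesis applies to both sub-urns at time \<open>t - x\<close>.
\<close>

theorem expectation_scaled_difference_power:
  assumes "two_type_urn M p clock mark" and s: "s = 2 * p - 1" "s \<ge> 0" and "t \<ge> 0"
  shows "(\<integral>\<omega>. scaled_difference s clock mark k t \<omega> ^ n \<partial>M) = truncated_moment s k n t"
  using assms(1,4)
proof (induction k arbitrary: clock mark t n)
  case 0
  interpret two_type_urn M p clock mark by fact
  show ?case
    using 0 by (simp add: scaled_difference_0 prob_space exp_of_nat_mult[symmetric] mult_ac)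
next
  case (Suc k)
  interpret two_type_urn M p clock mark by fact
  let ?B = "- {Inl ([], 0)} :: (nat list \<times> nat + nat list \<times> nat) set"
  let ?N = "PiM ?B (\<lambda>_. borel) :: (nat list \<times> nat + nat list \<times> nat \<Rightarrow> real) measure"
  let ?Y = "\<lambda>\<omega>. restrict (\<lambda>i. noise i \<omega>) ?B"
  let ?R = "scaled_difference s (clock \<circ> root_index) (mark \<circ> root_index) k"
  let ?C = "scaled_difference s (clock \<circ> child_index) (mark \<circ> child_index) k"
  define a where "a x = exp (- (1 + real n * s) * x) * branching_form s (\<lambda>j. truncated_moment s k j (t - x)) n" for x
  define F where "F = (\<lambda>(x, y). if t < x then exp (- s * t) ^ n else
     (exp (- s * x) * (coordinate_difference s root_index k (t - x) y +
        y (Inr ([], 0)) * coordinate_difference s child_index k (t - x) y)) ^ n)"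
  have sub: "coordinates root_index \<subseteq> ?B" "coordinates child_index \<subseteq> ?B"
    using first_notin_coordinates by auto
  have [measurable]: "(\<lambda>z. coordinate_difference s root_index k (t - fst z) (snd z)) \<in> borel_measurable (borel \<Otimes>\<^sub>M ?N)"
    "(\<lambda>z. coordinate_difference s child_index k (t - fst z) (snd z)) \<in> borel_measurable (borel \<Otimes>\<^sub>M ?N)"
    by (auto intro!: measurable_coordinate_difference[OF sub(1)] measurable_coordinate_difference[OF sub(2)])
  have [measurable]: "(\<lambda>z. snd z (Inr ([], 0))) \<in> borel_measurable (borel \<Otimes>\<^sub>M ?N)"
    by (rule measurable_compose[OF measurable_snd measurable_component_singleton]) auto
  have F_meas[measurable]: "F \<in> borel_measurable (borel \<Otimes>\<^sub>M ?N)"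
    unfolding F_def case_prod_beta by measurable
  have F_eq: "F (x, ?Y \<omega>) = (if t < x then exp (- s * t) ^ n else
      (exp (- s * x) * (?R (t - x) \<omega> + mark ([], 0) \<omega> * ?C (t - x) \<omega>)) ^ n)" for x \<omega>
    by (simp add: F_def coordinate_difference_noise[OF sub(1)] coordinate_difference_noise[OF sub(2)])
  have AE_eq: "AE \<omega> in M. scaled_difference s clock mark (Suc k) t \<omega> ^ n = F (clock ([], 0) \<omega>, ?Y \<omega>)"
    using AE_clock_nonneg
  proof eventually_elim
    case (elim \<omega>)
    then have "clock i \<omega> \<ge> 0" for i
      by blast
    from scaled_difference_Suc[where clock = clock, OF this \<open>t \<ge> 0\<close>] show ?case
      by (simp add: F_eq)
  qed
  have Y[measurable]: "?Y \<in> measurable M ?N"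
    by (intro measurable_restrict) auto
  have F_int: "integrable M (\<lambda>\<omega>. F (clock ([], 0) \<omega>, ?Y \<omega>))"
    using integrable_scaled_difference_power[OF s(2) \<open>t \<ge> 0\<close>, of "Suc k" n] AE_eq
    by (subst integrable_cong_AE) auto
  have joint: "distr M borel (clock ([], 0)) \<Otimes>\<^sub>M distr M ?N ?Y = distr M (borel \<Otimes>\<^sub>M ?N) (\<lambda>\<omega>. (clock ([], 0) \<omega>, ?Y \<omega>))"
    using joint_distribution_coordinate[OF independent, of "Inl ([], 0)" ?B] by simp
  note freeze = expectation_freeze[OF measurable_clock Y joint clock_exponential F_meas F_int]
  have inner: "exponential_density 1 x * expectation (\<lambda>\<omega>. F (x, ?Y \<omega>)) =
      exp (- (real n * s) * t) * (exponential_density 1 x * indicator {t<..} x) +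
      (if 0 \<le> x \<and> x \<le> t then a x else 0)" for x
  proof (cases "0 \<le> x \<and> x \<le> t")
    case True
    have "expectation (\<lambda>\<omega>. (?R (t - x) \<omega> + mark ([], 0) \<omega> * ?C (t - x) \<omega>) ^ n) =
        branching_form s (\<lambda>j. truncated_moment s k j (t - x)) n"
      using True s
      by (intro expectation_branch Suc.IH subfamily inj_root_index inj_child_index) auto
    moreover have "exp (- x) * exp (- (s * x)) ^ n = exp (- (1 + real n * s) * x)"
      by (simp add: exp_of_nat_mult[symmetric] exp_add[symmetric] algebra_simps)
    ultimately show ?thesis
      using True
      by (simp add: F_eq a_def exponential_density_def power_mult_distrib mult.assoc[symmetric])
  next
    case False
    then show ?thesis
      using \<open>t \<ge> 0\<close>
      by (auto simp: F_eq exponential_density_def prob_space exp_of_nat_mult[symmetric] mult_ac split: split_indicator)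
  qed
  have tail: "(\<integral>x. exponential_density 1 x * indicator {t<..} x \<partial>lborel) = exp (- t)"
    "integrable lborel (\<lambda>x. exponential_density 1 x * indicator {t<..} x :: real)"
  proof -
    have "(\<integral>x. exponential_density 1 x * indicator {t<..} x \<partial>lborel) = expectation (\<lambda>\<omega>. indicator {t<..} (clock ([], 0) \<omega>))"
      by (rule distributed_integral[OF clock_exponential]) (auto simp: exponential_density_nonneg)
    also have "\<dots> = expectation (indicator {\<omega>\<in>space M. t < clock ([], 0) \<omega>})"
      by (intro Bochner_Integration.integral_cong) (auto split: split_indicator)
    also have "\<dots> = exp (- t)"
      using exponential_distributedD_gt[OF clock_exponential \<open>t \<ge> 0\<close>] by simp
    finally show "(\<integral>x. exponential_density 1 x * indicator {t<..} x \<partial>lborel) = exp (- t)" .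
    then show "integrable lborel (\<lambda>x. exponential_density 1 x * indicator {t<..} x :: real)"
      using not_integrable_integral_eq by fastforce
  qed
  have int_a: "integrable lborel (\<lambda>x. if 0 \<le> x \<and> x \<le> t then a x else 0)"
    using Bochner_Integration.integrable_diff[OF freeze(1) integrable_mult_right[OF tail(2), of "exp (- (real n * s) * t)"]]
    unfolding inner by simp
  have "expectation (\<lambda>\<omega>. scaled_difference s clock mark (Suc k) t \<omega> ^ n) = expectation (\<lambda>\<omega>. F (clock ([], 0) \<omega>, ?Y \<omega>))"
    using AE_eq by (intro integral_cong_AE) auto
  also have "\<dots> = exp (- (real n * s) * t) * exp (- t) + (\<integral>x. (if 0 \<le> x \<and> x \<le> t then a x else 0) \<partial>lborel)"
    unfolding freeze(2) inner using tail int_a by simp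
  also have "\<dots> = truncated_moment s (Suc k) n t"
    unfolding a_def truncated_moment.simps(2) by (simp add: exp_add[symmetric] algebra_simps)
  finally show ?case .
qed

section \<open>Bounds from the renewal recursion\<close>

lemma has_bochner_integral_exp_Ici:
  fixes c :: real
  assumes "c > 0"
  shows "has_bochner_integral lborel (\<lambda>x. if 0 \<le> x then exp (- c * x) else 0) (1 / c)"
proof -
  interpret prob_space "density lborel (exponential_density c)"
    by (rule prob_space_exponential_density[OF assms])
  have "(\<integral>\<^sup>+x. ennreal (exponential_density c x) \<partial>lborel) = ennreal 1"
    using emeasure_space_1 by (simp add: emeasure_density)
  then have "has_bochner_integral lborel (exponential_density c) 1"
    using assms by (intro has_bochner_integral_nn_integral) (auto simp: exponential_density_nonneg)
  then have "has_bochner_integral lborel (\<lambda>x. 1 / c * exponential_density c x) (1 / c * 1)"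
    by (rule has_bochner_integral_mult_right)
  moreover have "(\<lambda>x. 1 / c * exponential_density c x) = (\<lambda>x. if 0 \<le> x then exp (- c * x) else 0)"
    using assms by (auto simp: exponential_density_def fun_eq_iff mult.commute)
  ultimately show ?thesis
    by simp
qed

lemma has_bochner_integral_exp_Icc:
  fixes c t :: real
  assumes "c > 0" "t \<ge> 0"
  shows "has_bochner_integral lborel (\<lambda>x. if 0 \<le> x \<and> x \<le> t then exp (- c * x) else 0) ((1 - exp (- c * t)) / c)"
proof -
  have "has_bochner_integral lborel (\<lambda>x. exp (- c * x) * indicator {0..t} x)
      (- exp (- c * t) / c - (- exp (- c * 0) / c))"
    using assms
    by (intro has_bochner_integral_FTC_Icc_nonneg) (auto intro!: derivative_eq_intros)
  moreover have "(\<lambda>x. exp (- c * x) * indicator {0..t} x) = (\<lambda>x. if 0 \<le> x \<and> x \<le> t then exp (- c * x) else 0)"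
    by (auto simp: fun_eq_iff split: split_indicator)
  moreover have "- exp (- c * t) / c - (- exp (- c * 0) / c) = (1 - exp (- c * t)) / c"
    by (simp add: diff_divide_distrib)
  ultimately show ?thesis
    by (simp only:)
qed

lemma exp_weighted_integral:
  fixes h :: "real \<Rightarrow> real"
  assumes "c > 0" "t \<ge> 0" and [measurable]: "h \<in> borel_measurable borel"
    and bound: "\<And>x. 0 \<le> x \<Longrightarrow> x \<le> t \<Longrightarrow> \<bar>h x\<bar> \<le> C"
  shows "integrable lborel (\<lambda>x. if 0 \<le> x \<and> x \<le> t then exp (- c * x) * h x else 0)"
    and "\<bar>\<integral>x. (if 0 \<le> x \<and> x \<le> t then exp (- c * x) * h x else 0) \<partial>lborel\<bar> \<le> C * ((1 - exp (- c * t)) / c)"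
proof -
  let ?f = "\<lambda>x. if 0 \<le> x \<and> x \<le> t then exp (- c * x) * h x else 0"
  let ?e = "\<lambda>x. if 0 \<le> x \<and> x \<le> t then exp (- c * x) else 0"
  have e: "integrable lborel ?e" "(\<integral>x. ?e x \<partial>lborel) = (1 - exp (- c * t)) / c"
    using has_bochner_integral_exp_Icc[OF assms(1,2)] by (auto simp: has_bochner_integral_iff)
  have le: "\<bar>?f x\<bar> \<le> C * ?e x" for x
    using bound[of x] by (auto simp: abs_mult mult.commute)
  show int: "integrable lborel ?f"
  proof (rule Bochner_Integration.integrable_bound)
    show "integrable lborel (\<lambda>x. C * ?e x)"
      using e by (intro integrable_mult_right)
    show "AE x in lborel. norm (?f x) \<le> norm (C * ?e x)"
      using le by (intro AE_I2) (metis abs_ge_self order_trans real_norm_def)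
  qed measurable
  have "\<bar>\<integral>x. ?f x \<partial>lborel\<bar> \<le> (\<integral>x. \<bar>?f x\<bar> \<partial>lborel)"
    by (rule integral_abs_bound)
  also have "\<dots> \<le> (\<integral>x. C * ?e x \<partial>lborel)"
    using int e(1) le by (intro integral_mono integrable_abs integrable_mult_right) auto
  also have "\<dots> = C * ((1 - exp (- c * t)) / c)"
    by (simp add: e(2))
  finally show "\<bar>\<integral>x. ?f x \<partial>lborel\<bar> \<le> C * ((1 - exp (- c * t)) / c)" .
qed

lemma branching_form_0: "branching_form s b 0 = b 0 * b 0"
  by (simp add: branching_form_def)

lemma branching_form_1: "b 0 = 1 \<Longrightarrow> branching_form s b 1 = (1 + s) * b 1"
  by (simp add: branching_form_def numeral_eq_Suc algebra_simps)

lemma branching_form_extremal_terms: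
  assumes "n \<ge> 1" "b 0 = 1"
  shows "branching_form s b n = (1 + (if even n then 1 else s)) * b n +
    (\<Sum>j\<in>{1..<n}. real (n choose j) * (if even j then 1 else s) * b j * b (n - j))"
proof -
  have *: "{..n} = insert 0 (insert n {1..<n})"
    using assms by auto
  show ?thesis
    unfolding branching_form_def * using assms by (simp add: algebra_simps)
qed

lemma truncated_moment_n0: "t \<ge> 0 \<Longrightarrow> truncated_moment s k 0 t = 1"
proof (induction k arbitrary: t)
  case (Suc k)
  have "truncated_moment s (Suc k) 0 t = exp (- t) + (\<integral>x. (if 0 \<le> x \<and> x \<le> t then exp (- 1 * x) else 0) \<partial>lborel)"
    using Suc
    by (auto simp: branching_form_0 cong: conj_cong intro!: Bochner_Integration.integral_cong)
  also have "\<dots> = 1"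
    using has_bochner_integral_exp_Icc[of 1 t] Suc.prems by (simp add: has_bochner_integral_iff)
  finally show ?case .
qed simp

text \<open>
  For the first moment the total weight \<open>(1 + s) exp (- (1 + s) x)\<close> has mass
  \<open>1 - exp (- (1 + s) t) < 1\<close> on \<open>[0, t]\<close>. The distance to the constant solution \<open>1\<close> therefore shrinks at
  least geometrically in the depth, uniformly for times up to \<open>T\<close>.
\<close>

lemma truncated_moment_n1:
  assumes "s > 0" "0 \<le> t" "t \<le> T"
  shows "0 \<le> 1 - truncated_moment s k 1 t \<and> 1 - truncated_moment s k 1 t \<le> (1 - exp (- (1 + s) * T)) ^ k"
  using assms(2,3)
proof (induction k arbitrary: t)
  case 0
  then show ?case
    using assms(1) by simp
next
  case (Suc k)
  define c where "c = 1 + s"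
  have "c > 0"
    using assms(1) by (simp add: c_def)
  let ?\<theta> = "1 - exp (- c * T)"
  let ?a = "truncated_moment s k 1"
  let ?e = "\<lambda>x. if 0 \<le> x \<and> x \<le> t then exp (- c * x) else 0"
  let ?f = "\<lambda>x. if 0 \<le> x \<and> x \<le> t then exp (- c * x) * (1 - ?a (t - x)) else 0"
  have \<theta>: "0 \<le> ?\<theta>"
    using Suc.prems \<open>c > 0\<close> by simp
  have IH: "0 \<le> 1 - ?a (t - x)" "1 - ?a (t - x) \<le> ?\<theta> ^ k" if "0 \<le> x" "x \<le> t" for x
    using Suc.IH[of "t - x"] that Suc.prems by (auto simp: c_def)
  have f: "integrable lborel ?f" "\<bar>\<integral>x. ?f x \<partial>lborel\<bar> \<le> ?\<theta> ^ k * ((1 - exp (- c * t)) / c)"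
    using exp_weighted_integral[OF \<open>c > 0\<close> \<open>0 \<le> t\<close>, of "\<lambda>x. 1 - ?a (t - x)" "?\<theta> ^ k"] IH by auto
  have e: "integrable lborel ?e" "(\<integral>x. ?e x \<partial>lborel) = (1 - exp (- c * t)) / c"
    using has_bochner_integral_exp_Icc[OF \<open>c > 0\<close> \<open>0 \<le> t\<close>] by (auto simp: has_bochner_integral_iff)
  have "truncated_moment s (Suc k) 1 t = exp (- c * t) + (\<integral>x. c * (?e x - ?f x) \<partial>lborel)"
  proof -
    have "branching_form s (\<lambda>j. truncated_moment s k j (t - x)) 1 = (1 + s) * ?a (t - x)" if "x \<le> t" for x
      using that by (intro branching_form_1) (simp add: truncated_moment_n0)
    then have "(if 0 \<le> x \<and> x \<le> t then exp (- (1 + real 1 * s) * x) *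
            branching_form s (\<lambda>j. truncated_moment s k j (t - x)) 1 else 0) = c * (?e x - ?f x)" for x
      by (auto simp: c_def algebra_simps)
    then show ?thesis
      unfolding truncated_moment.simps(2) by (simp add: c_def)
  qed
  also have "\<dots> = 1 - c * (\<integral>x. ?f x \<partial>lborel)"
    using e f(1) \<open>c > 0\<close> by (simp add: field_simps)
  finally have eq: "1 - truncated_moment s (Suc k) 1 t = c * (\<integral>x. ?f x \<partial>lborel)"
    by simp
  have nonneg: "(\<integral>x. ?f x \<partial>lborel) \<ge> 0"
    using IH by (intro integral_nonneg_AE AE_I2) auto
  have "c * (\<integral>x. ?f x \<partial>lborel) \<le> c * (?\<theta> ^ k * ((1 - exp (- c * t)) / c))"
    using f(2) nonneg \<open>c > 0\<close> by (intro mult_left_mono) auto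
  also have "\<dots> = ?\<theta> ^ k * (1 - exp (- c * t))"
    using \<open>c > 0\<close> by simp
  also have "\<dots> \<le> ?\<theta> ^ k * ?\<theta>"
    using \<theta> Suc.prems \<open>c > 0\<close> by (intro mult_left_mono) auto
  finally show ?case
    using nonneg \<open>c > 0\<close> unfolding eq by (simp add: c_def mult.commute)
qed

lemma truncated_moment_n1_tendsto:
  assumes "s > 0" "t \<ge> 0"
  shows "(\<lambda>k. truncated_moment s k 1 t) \<longlonglongrightarrow> 1"
proof -
  let ?\<theta> = "1 - exp (- (1 + s) * t)"
  have "0 \<le> (1 + s) * t"
    using assms by (intro mult_nonneg_nonneg) auto
  then have "0 \<le> ?\<theta>" "?\<theta> < 1"
    by (auto simp: algebra_simps)
  then have "(\<lambda>k. ?\<theta> ^ k) \<longlonglongrightarrow> 0"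
    by (rule LIMSEQ_realpow_zero)
  then have "(\<lambda>k. 1 - truncated_moment s k 1 t) \<longlonglongrightarrow> 0"
    by (rule tendsto_sandwich[rotated 2, OF tendsto_const])
      (use truncated_moment_n1[OF assms(1,2) order_refl] in auto)
  then show ?thesis
    using tendsto_diff[OF tendsto_const[of 1]] by fastforce
qed

text \<open>
  In the recursion for order \<open>n \<ge> 2\<close> the moment of order \<open>n\<close> itself occurs with factor at most \<open>2\<close>, and
  integration divides by \<open>1 + n s\<close>. Since \<open>s > 1/2\<close>, the quotient is below \<open>1\<close>, and the recursion
  preserves any sufficiently large bound, uniformly in depth and time. This is where \<open>p > 3/4\<close>
  enters; for smaller \<open>p\<close> already the second moment of the scaled difference diverges as \<open>t\<close> grows.
\<close>

lemma truncated_moment_bounded: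
  assumes "1/2 < s" "s \<le> 1"
  shows "\<exists>B. \<forall>k t. 0 \<le> t \<longrightarrow> \<bar>truncated_moment s k n t\<bar> \<le> B"
proof (induction n rule: less_induct)
  case (less n)
  consider "n = 0" | "n = 1" | "n \<ge> 2"
    by linarith
  then show ?case
  proof cases
    case 1
    then show ?thesis
      by (auto simp: truncated_moment_n0)
  next
    case 2
    have "\<bar>truncated_moment s k 1 t\<bar> \<le> 1" if "0 \<le> t" for k t
    proof -
      have "0 \<le> (1 + s) * t"
        using assms that by (intro mult_nonneg_nonneg) auto
      then have "(1 - exp (- (1 + s) * t)) ^ k \<le> 1"
        by (intro power_le_one) (auto simp: algebra_simps)
      then show ?thesis
        using truncated_moment_n1[of s t t k] assms that by auto
    qed
    with 2 show ?thesis
      by blast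
  next
    case 3
    obtain B where B: "\<And>j k t. j < n \<Longrightarrow> 0 \<le> t \<Longrightarrow> \<bar>truncated_moment s k j t\<bar> \<le> B j"
      using less.IH by metis
    have B_nonneg: "B j \<ge> 0" if "j < n" for j
      using B[OF that, of 0 0] by linarith
    define G where "G = (\<Sum>j\<in>{1..<n}. real (n choose j) * B j * B (n - j))"
    have "G \<ge> 0"
      unfolding G_def by (intro sum_nonneg mult_nonneg_nonneg B_nonneg) auto
    have "real n * s \<ge> 2 * s"
      using 3 assms by (intro mult_right_mono) auto
    then have ns: "real n * s > 1"
      using assms by linarith
    \<comment> \<open>the fixed point of \<open>C \<mapsto> 1 + (2 * C + G) / (1 + n s)\<close>\<close>
    define C where "C = (1 + real n * s + G) / (real n * s - 1)"
    have "C * (real n * s - 1) = 1 + real n * s + G"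
      using ns by (simp add: C_def)
    then have "2 * C + G = (C - 1) * (1 + real n * s)"
      by (simp add: algebra_simps)
    then have C_eq: "1 + (2 * C + G) / (1 + real n * s) = C"
      using ns by simp
    have "C \<ge> 1"
      using ns \<open>G \<ge> 0\<close> by (simp add: C_def field_simps)
    have "\<bar>truncated_moment s k n t\<bar> \<le> C" if "0 \<le> t" for k t
      using that
    proof (induction k arbitrary: t)
      case 0
      have "truncated_moment s 0 n t \<le> 1"
        using 0 ns by (simp add: mult_nonneg_nonneg)
      then have "truncated_moment s 0 n t \<le> C"
        using \<open>C \<ge> 1\<close> by linarith
      then show ?case
        by simp
    next
      case (Suc k)
      have form: "\<bar>branching_form s (\<lambda>j. truncated_moment s k j u) n\<bar> \<le> 2 * C + G" if "0 \<le> u" for u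
      proof -
        let ?a = "\<lambda>j. truncated_moment s k j u"
        have "\<bar>\<Sum>j\<in>{1..<n}. real (n choose j) * (if even j then 1 else s) * ?a j * ?a (n - j)\<bar> \<le> G"
          unfolding G_def
        proof (intro order_trans[OF sum_abs] sum_mono)
          fix j assume j: "j \<in> {1..<n}"
          then have "\<bar>?a j\<bar> \<le> B j" "\<bar>?a (n - j)\<bar> \<le> B (n - j)"
            using that by (auto intro!: B)
          then have "\<bar>?a j\<bar> * \<bar>?a (n - j)\<bar> \<le> B j * B (n - j)"
            using j by (intro mult_mono B_nonneg) auto
          moreover have "\<bar>if even j then 1 else s\<bar> \<le> 1"
            using assms by auto
          ultimately have "\<bar>if even j then 1 else s\<bar> * (\<bar>?a j\<bar> * \<bar>?a (n - j)\<bar>) \<le> 1 * (B j * B (n - j))"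
            by - (rule mult_mono, auto)
          then have "real (n choose j) * (\<bar>if even j then 1 else s\<bar> * (\<bar>?a j\<bar> * \<bar>?a (n - j)\<bar>)) \<le> real (n choose j) * (B j * B (n - j))"
            by (intro mult_left_mono) auto
          then show "\<bar>real (n choose j) * (if even j then 1 else s) * ?a j * ?a (n - j)\<bar> \<le> real (n choose j) * B j * B (n - j)"
            by (simp add: abs_mult mult.assoc)
        qed
        moreover have "\<bar>(1 + (if even n then 1 else s)) * ?a n\<bar> \<le> 2 * C"
          unfolding abs_mult using Suc.IH[OF that] assms by (intro mult_mono) auto
        ultimately show ?thesis
          using 3 that by (subst branching_form_extremal_terms) (auto simp: truncated_moment_n0)
      qed
      have c: "1 + real n * s > 0"
        using ns by simp
      have "(\<lambda>x. branching_form s (\<lambda>j. truncated_moment s k j (t - x)) n) \<in> borel_measurable borel"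
        unfolding branching_form_def by measurable
      from exp_weighted_integral(2)[OF c Suc.prems this, of "2 * C + G"] form
      have "\<bar>truncated_moment s (Suc k) n t - exp (- (1 + real n * s) * t)\<bar>
          \<le> (2 * C + G) * ((1 - exp (- (1 + real n * s) * t)) / (1 + real n * s))"
        by simp
      also have "\<dots> = (1 - exp (- (1 + real n * s) * t)) * ((2 * C + G) / (1 + real n * s))"
        by simp
      finally have "\<bar>truncated_moment s (Suc k) n t\<bar> \<le> exp (- (1 + real n * s) * t) * 1
         + (1 - exp (- (1 + real n * s) * t)) * ((2 * C + G) / (1 + real n * s))"
        using exp_ge_zero[of "- (1 + real n * s) * t"] by linarith
      also have "\<dots> \<le> 1 * 1 + 1 * ((2 * C + G) / (1 + real n * s))"
        using c Suc.prems mult_nonneg_nonneg[of "1 + real n * s" t, unfolded distrib_right] \<open>C \<ge> 1\<close> \<open>G \<ge> 0\<close>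
        by (intro add_mono mult_right_mono) (auto simp: left_diff_distrib)
      finally show ?case
        using C_eq by simp
    qed
    then show ?thesis
      by blast
  qed
qed

section \<open>Limit of the renewal recursion\<close>

lemma exp_weighted_integral_tendsto:
  fixes h :: "nat \<Rightarrow> real \<Rightarrow> real"
  assumes "c > 0" and [measurable]: "\<And>i. h i \<in> borel_measurable borel" "g \<in> borel_measurable borel"
    and bound: "\<And>i x. 0 \<le> x \<Longrightarrow> \<bar>h i x\<bar> \<le> C"
    and lim: "\<And>x. 0 \<le> x \<Longrightarrow> (\<lambda>i. h i x) \<longlonglongrightarrow> g x"
  shows "(\<lambda>i. \<integral>x. (if 0 \<le> x then exp (- c * x) * h i x else 0) \<partial>lborel)
    \<longlonglongrightarrow> (\<integral>x. (if 0 \<le> x then exp (- c * x) * g x else 0) \<partial>lborel)"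
proof (rule integral_dominated_convergence)
  show "integrable lborel (\<lambda>x. C * (if 0 \<le> x then exp (- c * x) else 0))"
    using has_bochner_integral_exp_Ici[OF \<open>c > 0\<close>] by (intro integrable_mult_right) (simp add: has_bochner_integral_iff)
  show "AE x in lborel. (\<lambda>i. if 0 \<le> x then exp (- c * x) * h i x else 0)
      \<longlonglongrightarrow> (if 0 \<le> x then exp (- c * x) * g x else 0)"
    using lim by (intro AE_I2) (auto intro!: tendsto_intros)
  show "AE x in lborel. norm (if 0 \<le> x then exp (- c * x) * h i x else 0) \<le> C * (if 0 \<le> x then exp (- c * x) else 0)" for i
    using bound by (intro AE_I2) (auto simp: abs_mult mult.commute)
qed auto

lemma tendsto_branching_form:
  assumes "\<And>j. ((\<lambda>i. b i j) \<longlongrightarrow> b' j) F"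
  shows "((\<lambda>i. branching_form s (b i) n) \<longlongrightarrow> branching_form s b' n) F"
  unfolding branching_form_def by (intro tendsto_intros assms)

lemma abs_branching_form_le:
  assumes "\<And>j. \<bar>b j\<bar> \<le> B j"
  shows "\<bar>branching_form s b n\<bar> \<le> (\<Sum>j\<le>n. real (n choose j) * (1 + \<bar>s\<bar>) * B j * B (n - j))"
  unfolding branching_form_def
proof (intro order_trans[OF sum_abs] sum_mono)
  fix j
  have "B j \<ge> 0"
    using assms[of j] by linarith
  then have "\<bar>b j\<bar> * \<bar>b (n - j)\<bar> \<le> B j * B (n - j)"
    using assms by (intro mult_mono) auto
  then have "\<bar>if even j then 1 else s\<bar> * (\<bar>b j\<bar> * \<bar>b (n - j)\<bar>) \<le> (1 + \<bar>s\<bar>) * (B j * B (n - j))"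
    by (rule mult_mono[rotated]) auto
  then have "real (n choose j) * (\<bar>if even j then 1 else s\<bar> * (\<bar>b j\<bar> * \<bar>b (n - j)\<bar>))
      \<le> real (n choose j) * ((1 + \<bar>s\<bar>) * (B j * B (n - j)))"
    by (intro mult_left_mono) auto
  then show "\<bar>real (n choose j) * (if even j then 1 else s) * b j * b (n - j)\<bar>
      \<le> real (n choose j) * (1 + \<bar>s\<bar>) * B j * B (n - j)"
    by (simp add: abs_mult mult.assoc)
qed

text \<open>
  Dominated convergence is applied to the renewal recursion twice: first let the depth tend to
  infinity, then the time. In the second limit the contribution of the initial ball vanishes, all
  moments under the integral converge to constants, and the remaining weight
  \<open>exp (- (1 + n s) x)\<close> integrates to \<open>1 / (1 + n s)\<close>.
\<close>

lemma limit_moment_recursion: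
  fixes A :: "nat \<Rightarrow> real \<Rightarrow> real" and r :: "nat \<Rightarrow> real"
  assumes "s > 0"
    and bound: "\<And>n k t. 0 \<le> t \<Longrightarrow> \<bar>truncated_moment s k n t\<bar> \<le> B n"
    and A: "\<And>n t. 0 \<le> t \<Longrightarrow> (\<lambda>k. truncated_moment s k n t) \<longlonglongrightarrow> A n t"
    and r: "\<And>n. (A n \<longlongrightarrow> r n) at_top"
  shows "(1 + real n * s) * r n = branching_form s r n"
proof -
  define c where "c = 1 + real n * s"
  have "c > 0"
    using \<open>s > 0\<close> by (simp add: c_def add_pos_nonneg)
  \<comment> \<open>agrees with \<open>A\<close> at nonnegative times, and is measurable on the whole real line\<close>
  define A' where "A' n t = lim (\<lambda>k. truncated_moment s k n t)" for n t
  have [measurable]: "A' n \<in> borel_measurable borel" for n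
    unfolding A'_def[abs_def] by measurable
  have A'_eq: "A' n t = A n t" if "0 \<le> t" for n t
    unfolding A'_def using A[OF that] by (rule limI)
  have A_bound: "\<bar>A' n t\<bar> \<le> B n" if "0 \<le> t" for n t
    unfolding A'_eq[OF that]
    using bound[OF that] by (intro LIMSEQ_le_const2[OF tendsto_rabs[OF A[OF that]]]) auto
  define C where "C = (\<Sum>j\<le>n. real (n choose j) * (1 + \<bar>s\<bar>) * B j * B (n - j))"
  have C_bound: "\<bar>branching_form s b n\<bar> \<le> C" if "\<And>j. \<bar>b j\<bar> \<le> B j" for b
    unfolding C_def using that by (rule abs_branching_form_le)
  have "0 \<le> C"
    using C_bound[of "\<lambda>j. truncated_moment s 0 j 0"] bound[of 0] by (meson abs_ge_zero order_refl order_trans)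
  have A_rec: "A' n t = exp (- c * t) +
      (\<integral>x. (if 0 \<le> x then exp (- c * x) * (if x \<le> t then branching_form s (\<lambda>j. A' j (t - x)) n else 0) else 0) \<partial>lborel)"
    if "0 \<le> t" for t
  proof (rule LIMSEQ_unique)
    show "(\<lambda>k. truncated_moment s (Suc k) n t) \<longlonglongrightarrow> A' n t"
      using A[OF that] unfolding A'_eq[OF that] by (rule LIMSEQ_Suc)
    have "(\<lambda>k. exp (- c * t) + (\<integral>x. (if 0 \<le> x then exp (- c * x) *
          (if x \<le> t then branching_form s (\<lambda>j. truncated_moment s k j (t - x)) n else 0) else 0) \<partial>lborel))
        \<longlonglongrightarrow> exp (- c * t) + (\<integral>x. (if 0 \<le> x then exp (- c * x) *
          (if x \<le> t then branching_form s (\<lambda>j. A' j (t - x)) n else 0) else 0) \<partial>lborel)"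
    proof (intro tendsto_add tendsto_const exp_weighted_integral_tendsto[where C = C] \<open>c > 0\<close>)
      show "\<bar>if x \<le> t then branching_form s (\<lambda>j. truncated_moment s k j (t - x)) n else 0\<bar> \<le> C" for k x
        using C_bound[of "\<lambda>j. truncated_moment s k j (t - x)"] bound[of "t - x"] \<open>0 \<le> C\<close>
        by (cases "x \<le> t") simp_all
      show "(\<lambda>k. if x \<le> t then branching_form s (\<lambda>j. truncated_moment s k j (t - x)) n else 0)
          \<longlonglongrightarrow> (if x \<le> t then branching_form s (\<lambda>j. A' j (t - x)) n else 0)" for x
      proof (cases "x \<le> t")
        case True
        then have "(\<lambda>k. branching_form s (\<lambda>j. truncated_moment s k j (t - x)) n) \<longlonglongrightarrow> branching_form s (\<lambda>j. A' j (t - x)) n"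
          using A[of "t - x"] A'_eq[of "t - x"] by (intro tendsto_branching_form) simp
        with True show ?thesis
          by simp
      qed simp
    qed (unfold branching_form_def, measurable)
    moreover have "truncated_moment s (Suc k) n t = exp (- c * t) + (\<integral>x. (if 0 \<le> x then exp (- c * x) *
          (if x \<le> t then branching_form s (\<lambda>j. truncated_moment s k j (t - x)) n else 0) else 0) \<partial>lborel)" for k
      unfolding truncated_moment.simps(2) c_def
      by (intro arg_cong2[where f = "(+)"] refl Bochner_Integration.integral_cong) auto
    ultimately show "(\<lambda>k. truncated_moment s (Suc k) n t) \<longlonglongrightarrow> exp (- c * t) + (\<integral>x. (if 0 \<le> x then exp (- c * x) *
          (if x \<le> t then branching_form s (\<lambda>j. A' j (t - x)) n else 0) else 0) \<partial>lborel)"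
      by simp
  qed
  have A'_lim: "(A' n \<longlongrightarrow> r n) at_top" for n
    using r[of n] by (rule Lim_transform_eventually) (auto simp: eventually_at_top_linorder A'_eq intro!: exI[of _ 0])
  have "r n = 0 + (\<integral>x. (if 0 \<le> x then exp (- c * x) * branching_form s r n else 0) \<partial>lborel)"
  proof (rule LIMSEQ_unique)
    show "(\<lambda>i. A' n (real i)) \<longlonglongrightarrow> r n"
      using filterlim_compose[OF A'_lim filterlim_real_sequentially] .
    have "(\<lambda>i. exp (- c * real i) + (\<integral>x. (if 0 \<le> x then exp (- c * x) *
          (if x \<le> real i then branching_form s (\<lambda>j. A' j (real i - x)) n else 0) else 0) \<partial>lborel))
        \<longlonglongrightarrow> 0 + (\<integral>x. (if 0 \<le> x then exp (- c * x) * branching_form s r n else 0) \<partial>lborel)"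
    proof (intro tendsto_add exp_weighted_integral_tendsto[where C = C] \<open>c > 0\<close>)
      have "(\<lambda>i. exp (- c) ^ i) \<longlonglongrightarrow> 0"
        using \<open>c > 0\<close> by (intro LIMSEQ_realpow_zero) auto
      then show "(\<lambda>i. exp (- c * real i)) \<longlonglongrightarrow> 0"
        by (simp add: exp_of_nat_mult[symmetric] mult.commute)
      show "\<bar>if x \<le> real i then branching_form s (\<lambda>j. A' j (real i - x)) n else 0\<bar> \<le> C" for i x
        using C_bound[of "\<lambda>j. A' j (real i - x)"] A_bound[of "real i - x"] \<open>0 \<le> C\<close>
        by (cases "x \<le> real i") simp_all
      show "(\<lambda>i. if x \<le> real i then branching_form s (\<lambda>j. A' j (real i - x)) n else 0)
          \<longlonglongrightarrow> branching_form s r n" for x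
      proof (rule Lim_transform_eventually)
        have "filterlim (\<lambda>i. - x + real i) at_top sequentially"
          by (rule filterlim_tendsto_add_at_top[OF tendsto_const filterlim_real_sequentially])
        then have "filterlim (\<lambda>i. real i - x) at_top sequentially"
          by simp
        then show "(\<lambda>i. branching_form s (\<lambda>j. A' j (real i - x)) n) \<longlonglongrightarrow> branching_form s r n"
          by (intro tendsto_branching_form filterlim_compose[OF A'_lim])
        have "\<forall>\<^sub>F i in sequentially. x \<le> real i"
          using filterlim_real_sequentially by (auto simp: filterlim_at_top)
        then show "\<forall>\<^sub>F i in sequentially. branching_form s (\<lambda>j. A' j (real i - x)) n =
            (if x \<le> real i then branching_form s (\<lambda>j. A' j (real i - x)) n else 0)"
          by eventually_elim simp
      qed
    qed (unfold branching_form_def, measurable)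
    then show "(\<lambda>i. A' n (real i)) \<longlonglongrightarrow> 0 + (\<integral>x. (if 0 \<le> x then exp (- c * x) * branching_form s r n else 0) \<partial>lborel)"
      unfolding A_rec[OF of_nat_0_le_iff] .
  qed
  also have "(\<integral>x. (if 0 \<le> x then exp (- c * x) * branching_form s r n else 0) \<partial>lborel) =
      (\<integral>x. branching_form s r n * (if 0 \<le> x then exp (- c * x) else 0) \<partial>lborel)"
    by (intro Bochner_Integration.integral_cong) auto
  also have "\<dots> = branching_form s r n / c"
    using has_bochner_integral_exp_Ici[OF \<open>c > 0\<close>] by (simp add: has_bochner_integral_iff)
  finally show ?thesis
    using \<open>c > 0\<close> by (simp add: c_def field_simps)
qed

section \<open>Folding the binomial sums\<close>

lemma sum_split_parity:
  fixes f :: "nat \<Rightarrow> real"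
  shows "(\<Sum>j\<in>{1..<2 * m + 1}. f j) = (\<Sum>i = 1..m. f (2 * i - 1)) + (\<Sum>i = 1..m. f (2 * i))"
  by (induction m) auto

text \<open>
  Apply Pascal's rule to each coefficient. Reflection \<open>j \<mapsto> n + 1 - j\<close> turns the part with
  \<open>n choose (j - 1)\<close> into the part with \<open>n choose j\<close>, so either of them may be doubled.
\<close>

lemma sum_choose_symmetric:
  fixes f :: "nat \<Rightarrow> real"
  assumes sym: "\<And>j. j \<le> Suc n \<Longrightarrow> f (Suc n - j) = f j"
  shows "(\<Sum>j\<in>{1..<Suc n}. real (Suc n choose j) * f j) = 2 * (\<Sum>j\<in>{1..<Suc n}. real (n choose j) * f j)"
    and "(\<Sum>j\<in>{1..<Suc n}. real (Suc n choose j) * f j) = 2 * (\<Sum>j\<in>{1..<Suc n}. real (n choose (j - 1)) * f j)"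
proof -
  have eq: "(\<Sum>j\<in>{1..<Suc n}. real (n choose (j - 1)) * f j) = (\<Sum>j\<in>{1..<Suc n}. real (n choose j) * f j)"
  proof (rule sum.reindex_bij_witness[of _ "\<lambda>j. Suc n - j" "\<lambda>j. Suc n - j"])
    fix j assume j: "j \<in> {1..<Suc n}"
    then have "n - (j - 1) = Suc n - j" "j - 1 \<le> n"
      by auto
    then have "n choose (j - 1) = n choose (Suc n - j)"
      using binomial_symmetric[of "j - 1" n] by (simp only:)
    then show "real (n choose (Suc n - j)) * f (Suc n - j) = real (n choose (j - 1)) * f j"
      using sym[of j] j by simp
  qed auto
  have "real (Suc n choose j) * f j = real (n choose (j - 1)) * f j + real (n choose j) * f j"
    if "j \<in> {1..<Suc n}" for j
    using that by (cases j) (auto simp: algebra_simps)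
  then have "(\<Sum>j\<in>{1..<Suc n}. real (Suc n choose j) * f j) =
      (\<Sum>j\<in>{1..<Suc n}. real (n choose (j - 1)) * f j) + (\<Sum>j\<in>{1..<Suc n}. real (n choose j) * f j)"
    unfolding sum.distrib[symmetric] by (rule sum.cong[OF refl])
  with eq show "(\<Sum>j\<in>{1..<Suc n}. real (Suc n choose j) * f j) = 2 * (\<Sum>j\<in>{1..<Suc n}. real (n choose j) * f j)"
    "(\<Sum>j\<in>{1..<Suc n}. real (Suc n choose j) * f j) = 2 * (\<Sum>j\<in>{1..<Suc n}. real (n choose (j - 1)) * f j)"
    by linarith+
qed

text \<open>
  The extremal terms \<open>j = 0\<close> and \<open>j = n + 1\<close> both carry coefficient \<open>1\<close> and move to the left. As \<open>n + 1\<close>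
  is even, reflection preserves the parity of \<open>j\<close>, so the even and the odd terms can be folded
  separately: the even ones with \<open>n choose (j - 1)\<close>, the odd ones with \<open>n choose j\<close>.
\<close>

lemma branching_recursion_odd_index:
  fixes r :: "nat \<Rightarrow> real"
  assumes rec: "(1 + real (n + 1) * s) * r (n + 1) = branching_form s r (n + 1)"
    and "r 0 = 1" "odd n"
  shows "(real (n + 1) * s - 1) * r (n + 1) =
         2 * (\<Sum>i = 1..(n - 1) div 2. real (n choose (2 * i - 1)) * r (2 * i) * r (n + 1 - 2 * i))
       + 2 * s * (\<Sum>i = 1..(n + 1) div 2. real (n choose (2 * i - 1)) * r (2 * i - 1) * r (n + 2 - 2 * i))"
proof -
  obtain m where n: "n = 2 * m + 1"
    using \<open>odd n\<close> by (rule oddE)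
  define f where "f j = r j * r (Suc n - j)" for j
  define e where "e j = (if even j then f j else 0)" for j
  define d where "d j = (if even j then 0 else f j)" for j
  have f_sym: "f (Suc n - j) = f j" if "j \<le> Suc n" for j
    using that by (simp add: f_def mult.commute)
  have parity_split: "(\<Sum>j\<in>{1..<Suc n}. real (Suc n choose j) * (if even j then 1 else s) * r j * r (Suc n - j)) =
      (\<Sum>j\<in>{1..<Suc n}. real (Suc n choose j) * e j) + s * (\<Sum>j\<in>{1..<Suc n}. real (Suc n choose j) * d j)"
    unfolding sum_distrib_left sum.distrib[symmetric]
    by (intro sum.cong) (auto simp: e_def d_def f_def)
  have "(1 + real (n + 1) * s) * r (n + 1) = 2 * r (n + 1) +
      ((\<Sum>j\<in>{1..<Suc n}. real (Suc n choose j) * e j) + s * (\<Sum>j\<in>{1..<Suc n}. real (Suc n choose j) * d j))"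
    unfolding rec using \<open>r 0 = 1\<close> \<open>odd n\<close>
    by (subst branching_form_extremal_terms) (simp_all add: parity_split[unfolded One_nat_def] del: sum.op_ivl_Suc)
  moreover have "(\<Sum>j\<in>{1..<Suc n}. real (Suc n choose j) * e j) =
      2 * (\<Sum>i = 1..m. real (n choose (2 * i - 1)) * r (2 * i) * r (n + 1 - 2 * i))"
  proof -
    have "(\<Sum>j\<in>{1..<Suc n}. real (n choose (j - 1)) * e j) = (\<Sum>j\<in>{1..<2 * m + 1}. real (n choose (j - 1)) * e j)"
      by (simp add: n e_def)
    also have "\<dots> = (\<Sum>i = 1..m. real (n choose (2 * i - 1)) * e (2 * i))"
      unfolding sum_split_parity by (simp add: e_def)
    finally show ?thesis
      using \<open>odd n\<close> by (subst sum_choose_symmetric(2)) (auto simp: e_def f_sym f_def mult.assoc)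
  qed
  moreover have "(\<Sum>j\<in>{1..<Suc n}. real (Suc n choose j) * d j) =
      2 * (\<Sum>i = 1..m + 1. real (n choose (2 * i - 1)) * r (2 * i - 1) * r (n + 2 - 2 * i))"
  proof -
    have "(\<Sum>j\<in>{1..<Suc n}. real (n choose j) * d j) =
        (\<Sum>j\<in>{1..<2 * m + 1}. real (n choose j) * d j) + real (n choose (2 * m + 1)) * d (2 * m + 1)"
      by (simp add: n)
    also have "\<dots> = (\<Sum>i = 1..m + 1. real (n choose (2 * i - 1)) * d (2 * i - 1))"
      unfolding sum_split_parity by (simp add: d_def)
    also have "\<dots> = (\<Sum>i = 1..m + 1. real (n choose (2 * i - 1)) * r (2 * i - 1) * r (n + 2 - 2 * i))"
    proof (intro sum.cong refl)
      fix i assume "i \<in> {1..m + 1}"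
      then have "odd (2 * i - 1)" "Suc n - (2 * i - 1) = n + 2 - 2 * i"
        by auto
      then show "real (n choose (2 * i - 1)) * d (2 * i - 1) =
          real (n choose (2 * i - 1)) * r (2 * i - 1) * r (n + 2 - 2 * i)"
        by (simp add: d_def f_def)
    qed
    finally show ?thesis
      using \<open>odd n\<close> by (subst sum_choose_symmetric(1)) (auto simp: d_def f_sym)
  qed
  moreover have "(n - 1) div 2 = m" "(n + 1) div 2 = m + 1"
    by (simp_all add: n)
  ultimately show ?thesis
    by (simp add: algebra_simps)
qed

text \<open>
  Here \<open>n + 1\<close> is odd, so reflection exchanges even and odd \<open>j\<close>: the odd terms, which carry \<open>s\<close>, repeat the
  even ones, which carry \<open>1\<close>. The extremal terms contribute \<open>1 + s\<close> for the same reason.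
\<close>

lemma branching_recursion_even_index:
  fixes r :: "nat \<Rightarrow> real"
  assumes rec: "(1 + real (n + 1) * s) * r (n + 1) = branching_form s r (n + 1)"
    and "r 0 = 1" "even n"
  shows "real n * s * r (n + 1) =
         (1 + s) * (\<Sum>i = 1..n div 2.
           (real (n choose (2 * i - 1)) + real (n choose (2 * i))) * r (2 * i) * r (n + 1 - 2 * i))"
proof -
  obtain m where n: "n = 2 * m"
    using \<open>even n\<close> by (rule evenE)
  define g where "g j = real (Suc n choose j) * r j * r (Suc n - j)" for j
  have g_sym: "g (Suc n - j) = g j" if "j \<le> Suc n" for j
    using that binomial_symmetric[OF that] unfolding g_def by (simp only: diff_diff_cancel mult_ac)
  have reflect: "(\<Sum>i = 1..m. g (2 * i - 1)) = (\<Sum>i = 1..m. g (2 * i))"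
  proof (rule sum.reindex_bij_witness[of _ "\<lambda>i. Suc m - i" "\<lambda>i. Suc m - i"])
    fix i assume "i \<in> {1..m}"
    then have "2 * (Suc m - i) = Suc n - (2 * i - 1)" "2 * i - 1 \<le> Suc n"
      by (auto simp: n)
    then show "g (2 * (Suc m - i)) = g (2 * i - 1)"
      using g_sym by metis
  qed auto
  have "(\<Sum>j\<in>{1..<Suc n}. real (Suc n choose j) * (if even j then 1 else s) * r j * r (Suc n - j)) =
      (\<Sum>j\<in>{1..<2 * m + 1}. (if even j then 1 else s) * g j)"
    by (intro sum.cong) (auto simp: g_def n)
  also have "\<dots> = (\<Sum>i = 1..m. s * g (2 * i - 1)) + (\<Sum>i = 1..m. g (2 * i))"
    unfolding sum_split_parity by (intro arg_cong2[where f = "(+)"] sum.cong) auto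
  also have "\<dots> = (1 + s) * (\<Sum>i = 1..m. g (2 * i))"
    unfolding sum_distrib_left[symmetric] reflect by (simp add: distrib_right)
  also have "(\<Sum>i = 1..m. g (2 * i)) = (\<Sum>i = 1..m.
      (real (n choose (2 * i - 1)) + real (n choose (2 * i))) * r (2 * i) * r (n + 1 - 2 * i))"
  proof (intro sum.cong refl)
    fix i assume "i \<in> {1..m}"
    then obtain l where "i = Suc l"
      by (cases i) auto
    then show "g (2 * i) = (real (n choose (2 * i - 1)) + real (n choose (2 * i))) * r (2 * i) * r (n + 1 - 2 * i)"
      by (simp add: g_def)
  qed
  finally have "(1 + real (n + 1) * s) * r (n + 1) = (1 + s) * r (n + 1) + (1 + s) * (\<Sum>i = 1..m.
      (real (n choose (2 * i - 1)) + real (n choose (2 * i))) * r (2 * i) * r (n + 1 - 2 * i))"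
    unfolding rec using \<open>r 0 = 1\<close> \<open>even n\<close>
    by (subst branching_form_extremal_terms) simp_all
  moreover have "n div 2 = m"
    by (simp add: n)
  ultimately show ?thesis
    by (simp add: algebra_simps)
qed

section \<open>Almost sure finiteness of the population\<close>

text \<open>
  A bound on these sums that is uniform in \<open>k\<close> limits the number of births before any given time. The
  rate \<open>2\<close> exceeds the growth rate \<open>1\<close> of the expected population, hence the expectation over all
  labels is finite.
\<close>

definition birth_weight :: "(nat list \<times> nat \<Rightarrow> 'w \<Rightarrow> real) \<Rightarrow> nat \<Rightarrow> 'w \<Rightarrow> real" where
  "birth_weight clock k \<omega> = (\<Sum>u\<in>labels k. exp (- 2 * birth_time clock \<omega> u))"

lemma birth_weight_Suc:
  "birth_weight clock (Suc k) \<omega> = 1 + exp (- 2 * clock ([], 0) \<omega>) *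
     (birth_weight (clock \<circ> child_index) k \<omega> + birth_weight (clock \<circ> root_index) k \<omega> - 1)"
proof -
  let ?e = "exp (- 2 * clock ([], 0) \<omega>)"
  have e: "exp (- 2 * (a + b)) = exp (- 2 * a) * exp (- 2 * b)" for a b :: real
    by (simp add: exp_add[symmetric])
  have "(\<Sum>u\<in>labels k. exp (- 2 * birth_time clock \<omega> (u @ [0]))) = ?e * birth_weight (clock \<circ> child_index) k \<omega>"
    unfolding birth_weight_def birth_time_child e sum_distrib_left ..
  moreover have "(\<Sum>u\<in>labels k. exp (- 2 * birth_time clock \<omega> (delay u))) =
      1 + ?e * (birth_weight (clock \<circ> root_index) k \<omega> - 1)"
  proof -
    have "(\<Sum>u\<in>labels k - {[]}. exp (- 2 * birth_time clock \<omega> (delay u))) =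
        (\<Sum>u\<in>labels k - {[]}. ?e * exp (- 2 * birth_time (clock \<circ> root_index) \<omega> u))"
      by (intro sum.cong refl) (simp add: birth_time_delay e[simplified])
    then show ?thesis
      by (simp add: birth_weight_def sum.remove[OF finite_labels Nil_in_labels] sum_distrib_left)
  qed
  ultimately show ?thesis
    by (simp add: birth_weight_def[of clock] sum_labels_Suc algebra_simps)
qed

lemma abs_birth_weight_le:
  assumes "\<And>i. clock i \<omega> \<ge> 0"
  shows "\<bar>birth_weight clock k \<omega>\<bar> \<le> card (labels k)"
proof -
  have "\<bar>exp (- 2 * birth_time clock \<omega> u)\<bar> \<le> 1" for u
    using birth_time_nonneg[of clock \<omega> u] assms by simp
  then have "\<bar>birth_weight clock k \<omega>\<bar> \<le> (\<Sum>u\<in>labels k. 1)"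
    unfolding birth_weight_def by (intro order_trans[OF sum_abs] sum_mono)
  then show ?thesis
    by simp
qed

lemma measurable_birth_weight [measurable]:
  assumes [measurable]: "\<And>i. clock i \<in> borel_measurable N"
  shows "birth_weight clock k \<in> borel_measurable N"
  unfolding birth_weight_def[abs_def] by measurable

lemma birth_weight_cong:
  assumes "\<And>i. clock i \<omega> = clock' i \<omega>'"
  shows "birth_weight clock k \<omega> = birth_weight clock' k \<omega>'"
proof -
  have "birth_time clock \<omega> u = birth_time clock' \<omega>' u" for u
    by (induction u) (simp_all add: assms)
  then show ?thesis
    by (simp add: birth_weight_def)
qed

context two_type_urn
begin

lemma integrable_birth_weight: "integrable M (birth_weight clock k)"
proof (rule integrable_const_bound)
  show "AE \<omega> in M. norm (birth_weight clock k \<omega>) \<le> card (labels k)"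
    using AE_clock_nonneg
  proof eventually_elim
    case (elim \<omega>)
    then show ?case
      using abs_birth_weight_le[of clock \<omega> k] by (simp only: real_norm_def)
  qed
qed measurable

lemma expectation_exp_clock: "expectation (\<lambda>\<omega>. exp (- 2 * clock i \<omega>)) = 1 / 3"
proof -
  have "expectation (\<lambda>\<omega>. exp (- 2 * clock i \<omega>)) = (\<integral>x. exponential_density 1 x * exp (- 2 * x) \<partial>lborel)"
    by (rule distributed_integral[OF clock_exponential, symmetric]) (auto simp: exponential_density_nonneg)
  also have "\<dots> = (\<integral>x. (if 0 \<le> x then exp (- 3 * x) else 0) \<partial>lborel)"
    by (intro Bochner_Integration.integral_cong) (auto simp: exponential_density_def exp_add[symmetric])
  also have "\<dots> = 1 / 3"
    using has_bochner_integral_exp_Ici[of 3] by (simp add: has_bochner_integral_iff)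
  finally show ?thesis .
qed

lemma integrable_exp_clock: "integrable M (\<lambda>\<omega>. exp (- 2 * clock i \<omega>))"
  using expectation_exp_clock[of i] not_integrable_integral_eq by fastforce

end

text \<open>
  By \<open>birth_weight_Suc\<close> consecutive expectations \<open>e\<close>, \<open>e'\<close> satisfy \<open>e' = 1 + (2 e - 1) / 3\<close>, with fixed point \<open>2\<close>;
  the first one is \<open>1\<close>.
\<close>

lemma expectation_birth_weight_le:
  assumes "two_type_urn M p clock mark"
  shows "integral\<^sup>L M (birth_weight clock k) \<le> 2"
  using assms
proof (induction k arbitrary: clock mark)
  case 0
  interpret two_type_urn M p clock mark by fact
  show ?case
    by (simp add: birth_weight_def prob_space)
next
  case (Suc k)
  interpret two_type_urn M p clock mark by fact
  interpret root: two_type_urn M p "clock \<circ> root_index" "mark \<circ> root_index"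
    by (rule subfamily[OF inj_root_index])
  interpret child: two_type_urn M p "clock \<circ> child_index" "mark \<circ> child_index"
    by (rule subfamily[OF inj_child_index])
  let ?rest = "\<lambda>\<omega>. birth_weight (clock \<circ> child_index) k \<omega> + birth_weight (clock \<circ> root_index) k \<omega> - 1"
  let ?A = "{Inl ([], 0)} :: (nat list \<times> nat + nat list \<times> nat) set"
  let ?N = "PiM (- ?A) (\<lambda>_. borel) :: (nat list \<times> nat + nat list \<times> nat \<Rightarrow> real) measure"
  let ?c = "\<lambda>h i y. y (Inl (h i))"
  have avoid: "Inl (child_index i) \<in> - ?A" "Inl (root_index i) \<in> - ?A" for i
    using first_neq_child_index[of i, symmetric] first_neq_root_index[of i, symmetric] by auto
  have [measurable]: "?c child_index i \<in> borel_measurable ?N" "?c root_index i \<in> borel_measurable ?N" for i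
    using avoid by (auto intro!: measurable_component_singleton simp del: Compl_iff)
  have coord: "birth_weight (?c child_index) k (restrict (\<lambda>i. noise i \<omega>) (- ?A)) = birth_weight (clock \<circ> child_index) k \<omega>"
    "birth_weight (?c root_index) k (restrict (\<lambda>i. noise i \<omega>) (- ?A)) = birth_weight (clock \<circ> root_index) k \<omega>" for \<omega>
    using avoid by (auto intro!: birth_weight_cong simp del: Compl_iff)
  have "indep_var borel (\<lambda>\<omega>. exp (- 2 * (restrict (\<lambda>i. noise i \<omega>) ?A (Inl ([], 0)))))
      borel (\<lambda>\<omega>. birth_weight (?c child_index) k (restrict (\<lambda>i. noise i \<omega>) (- ?A)) +
        birth_weight (?c root_index) k (restrict (\<lambda>i. noise i \<omega>) (- ?A)) - 1)"
    by (rule indep_var_coordinates[OF independent]) (auto, measurable)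
  then have iv: "indep_var borel (\<lambda>\<omega>. exp (- 2 * clock ([], 0) \<omega>)) borel ?rest"
    unfolding coord by simp
  have int: "integrable M ?rest"
    using root.integrable_birth_weight child.integrable_birth_weight by auto
  have "expectation (birth_weight clock (Suc k)) = 1 + expectation (\<lambda>\<omega>. exp (- 2 * clock ([], 0) \<omega>) * ?rest \<omega>)"
    unfolding birth_weight_Suc
    using indep_var_integrable[OF iv integrable_exp_clock int] by (simp add: prob_space)
  also have "\<dots> = 1 + 1 / 3 * expectation ?rest"
    by (subst indep_var_lebesgue_integral[OF iv integrable_exp_clock int]) (simp only: expectation_exp_clock)
  also have "expectation ?rest = expectation (birth_weight (clock \<circ> child_index) k)
      + expectation (birth_weight (clock \<circ> root_index) k) - 1"
    using root.integrable_birth_weight child.integrable_birth_weight by (simp add: prob_space)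
  finally have split: "expectation (birth_weight clock (Suc k)) = 1 + 1 / 3 *
      (expectation (birth_weight (clock \<circ> child_index) k)
       + expectation (birth_weight (clock \<circ> root_index) k) - 1)" .
  have "x \<le> 2" if "x = 1 + 1 / 3 * (a + b - 1)" "a \<le> 2" "b \<le> 2" for x a b :: real
    using that by simp
  from this[OF split Suc.IH[OF child.two_type_urn_axioms] Suc.IH[OF root.two_type_urn_axioms]]
  show ?case .
qed

context two_type_urn
begin

text \<open>
  By monotone convergence the sum of \<open>exp (- 2 b)\<close> over the birth times \<open>b\<close> of all labels is almost surely
  some finite \<open>C\<close>. Each ball present at time \<open>t\<close> contributes at least \<open>exp (- 2 t)\<close>, so there are at most
  \<open>C exp (2 t)\<close> of them.
\<close>

lemma AE_finite_population: "AE \<omega> in M. \<forall>t. finite {u. birth_time clock \<omega> u \<le> t}"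
proof -
  define S where "S k \<omega> = ennreal (birth_weight clock k \<omega>)" for k \<omega>
  have [measurable]: "S k \<in> borel_measurable M" for k
    unfolding S_def[abs_def] by measurable
  have nonneg: "birth_weight clock k \<omega> \<ge> 0" for k \<omega>
    unfolding birth_weight_def by (intro sum_nonneg) simp
  have "birth_weight clock k \<omega> \<le> birth_weight clock l \<omega>" if "k \<le> l" for k l \<omega>
    unfolding birth_weight_def using mono_labels[OF that] by (intro sum_mono2) auto
  then have inc: "incseq S"
    by (auto simp: incseq_def le_fun_def S_def intro!: ennreal_leI)
  have "(\<integral>\<^sup>+\<omega>. (SUP k. S k \<omega>) \<partial>M) = (SUP k. \<integral>\<^sup>+\<omega>. S k \<omega> \<partial>M)"
    by (rule nn_integral_monotone_convergence_SUP[OF inc]) auto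
  also have "\<dots> \<le> ennreal 2"
  proof (rule SUP_least)
    fix k
    show "(\<integral>\<^sup>+\<omega>. S k \<omega> \<partial>M) \<le> ennreal 2"
      unfolding S_def nn_integral_eq_integral[OF integrable_birth_weight AE_I2[OF nonneg]]
      by (rule ennreal_leI[OF expectation_birth_weight_le[OF two_type_urn_axioms]])
  qed
  finally have "(\<integral>\<^sup>+\<omega>. (SUP k. S k \<omega>) \<partial>M) \<noteq> \<infinity>"
    by (auto simp: top_unique)
  then have "AE \<omega> in M. (SUP k. S k \<omega>) \<noteq> \<infinity>"
    by (intro nn_integral_PInf_AE) auto
  then show ?thesis
  proof eventually_elim
    case (elim \<omega>)
    then obtain C where C: "0 \<le> C" "(SUP k. S k \<omega>) = ennreal C"
      by (cases "SUP k. S k \<omega>") auto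
    have le: "birth_weight clock k \<omega> \<le> C" for k
      using SUP_upper[of k UNIV "\<lambda>k. S k \<omega>"] C by (simp add: S_def)
    show ?case
    proof
      fix t
      have "card G \<le> nat \<lceil>C * exp (2 * t)\<rceil>" if G: "G \<subseteq> {u. birth_time clock \<omega> u \<le> t}" "finite G" for G
      proof -
        obtain k where k: "depth ` G \<subseteq> {..k}"
          using G(2) finite_nat_iff_bounded_le by (metis finite_imageI)
        have "real (card G) * exp (- 2 * t) = (\<Sum>u\<in>G. exp (- 2 * t))"
          by simp
        also have "\<dots> \<le> (\<Sum>u\<in>G. exp (- 2 * birth_time clock \<omega> u))"
          using G by (intro sum_mono) auto
        also have "\<dots> \<le> birth_weight clock k \<omega>"
          unfolding birth_weight_def using k by (intro sum_mono2 finite_labels) (auto simp: labels_def)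
        finally have "real (card G) * exp (- 2 * t) * exp (2 * t) \<le> C * exp (2 * t)"
          using le[of k] by (intro mult_right_mono) auto
        then have "real (card G) \<le> C * exp (2 * t)"
          by (simp add: mult.assoc exp_add[symmetric])
        then show ?thesis
          by linarith
      qed
      then show "finite {u. birth_time clock \<omega> u \<le> t}"
        using finite_if_finite_subsets_card_bdd by blast
    qed
  qed
qed

text \<open>
  Almost surely the population at time \<open>t\<close> is finite, and a finite set of labels has bounded depth, so
  the truncation is eventually void. Finiteness also excludes the convention that infinite sets
  have cardinality \<open>0\<close>.
\<close>

lemma AE_scaled_difference_eventually:
  "AE \<omega> in M. \<forall>t. \<forall>\<^sub>F k in sequentially. scaled_difference s clock mark k t \<omega> =
     (real (urn_count clock mark \<omega> t 1) - real (urn_count clock mark \<omega> t (- 1))) / exp (s * t)"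
  using AE_finite_population AE_mark
proof eventually_elim
  case (elim \<omega>)
  show ?case
  proof
    fix t
    let ?P = "{u. birth_time clock \<omega> u \<le> t}" and ?T = "ball_type mark \<omega>"
    have fin: "finite ?P"
      using elim by blast
    have type: "?T u \<in> {1, - 1}" for u
      using elim by (intro ball_type_sign) blast
    obtain K where K: "depth ` ?P \<subseteq> {..K}"
      using fin finite_nat_iff_bounded_le by (metis finite_imageI)
    have "(\<Sum>u\<in>?P. ?T u) = (\<Sum>u\<in>?P. of_bool (?T u = 1) - of_bool (?T u = - 1))"
      using type by (intro sum.cong) auto
    also have "\<dots> = real (card {u \<in> ?P. ?T u = 1}) - real (card {u \<in> ?P. ?T u = - 1})"
      using fin by (simp add: sum_subtractf sum.If_cases Int_def)
    finally have count: "(\<Sum>u\<in>?P. ?T u) = real (urn_count clock mark \<omega> t 1) - real (urn_count clock mark \<omega> t (- 1))"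
      by (simp add: urn_count_def)
    have "scaled_difference s clock mark k t \<omega> = (\<Sum>u\<in>?P. ?T u) / exp (s * t)" if "k \<ge> K" for k
    proof -
      have "(\<Sum>u\<in>labels k. of_bool (birth_time clock \<omega> u \<le> t) * ?T u) = (\<Sum>u\<in>?P. ?T u)"
        using K that by (intro sum.mono_neutral_cong_right finite_labels) (auto simp: labels_def)
      then show ?thesis
        by (simp add: scaled_difference_def exp_minus divide_inverse mult.commute)
    qed
    then show "\<forall>\<^sub>F k in sequentially. scaled_difference s clock mark k t \<omega> =
        (real (urn_count clock mark \<omega> t 1) - real (urn_count clock mark \<omega> t (- 1))) / exp (s * t)"
      unfolding eventually_sequentially count by blast
  qed
qed

end

section \<open>Moments of the limit\<close>

text \<open>
  Bounded second moments imply uniform integrability. With \<open>D = \<bar>X - Y\<bar>\<close> and any level \<open>R\<close> one has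
  \<open>D \<le> min D R + D\<^sup>2 / R\<close>; the first part tends to \<open>0\<close> in mean by dominated convergence, the second
  is uniformly small for large \<open>R\<close>. Fatou's lemma supplies the second moment of the limit.
\<close>

lemma (in prob_space) expectation_tendsto_of_second_moments:
  fixes X :: "nat \<Rightarrow> 'a \<Rightarrow> real"
  assumes [measurable]: "\<And>i. random_variable borel (X i)" "random_variable borel Y"
    and lim: "AE \<omega> in M. (\<lambda>i. X i \<omega>) \<longlonglongrightarrow> Y \<omega>"
    and int: "\<And>i. integrable M (\<lambda>\<omega>. X i \<omega> ^ 2)"
    and bound: "\<And>i. expectation (\<lambda>\<omega>. X i \<omega> ^ 2) \<le> C"
  shows "(\<lambda>i. expectation (X i)) \<longlonglongrightarrow> expectation Y"
    and "integrable M (\<lambda>\<omega>. Y \<omega> ^ 2)" "expectation (\<lambda>\<omega>. Y \<omega> ^ 2) \<le> C"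
proof -
  have "C \<ge> 0"
    using bound[of 0] by (smt (verit) integral_nonneg_AE AE_I2 zero_le_power2)
  have "(\<integral>\<^sup>+\<omega>. ennreal (Y \<omega> ^ 2) \<partial>M) = (\<integral>\<^sup>+\<omega>. liminf (\<lambda>i. ennreal (X i \<omega> ^ 2)) \<partial>M)"
  proof (rule nn_integral_cong_AE)
    show "AE \<omega> in M. ennreal (Y \<omega> ^ 2) = liminf (\<lambda>i. ennreal (X i \<omega> ^ 2))"
      using lim
      by eventually_elim (intro lim_imp_Liminf[symmetric] tendsto_ennrealI tendsto_power, auto)
  qed
  also have "\<dots> \<le> liminf (\<lambda>i. \<integral>\<^sup>+\<omega>. ennreal (X i \<omega> ^ 2) \<partial>M)"
    by (rule nn_integral_liminf) auto
  also have "\<dots> = liminf (\<lambda>i. ennreal (expectation (\<lambda>\<omega>. X i \<omega> ^ 2)))"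
    by (subst nn_integral_eq_integral) (auto simp: int)
  also have "\<dots> \<le> ennreal C"
    using bound by (intro Liminf_le) (auto intro!: always_eventually ennreal_leI)
  finally have nnY: "(\<integral>\<^sup>+\<omega>. ennreal (Y \<omega> ^ 2) \<partial>M) \<le> ennreal C" .
  show intY: "integrable M (\<lambda>\<omega>. Y \<omega> ^ 2)"
    using nnY by (intro integrableI_nonneg) (auto simp: top_unique intro: le_less_trans)
  show boundY: "expectation (\<lambda>\<omega>. Y \<omega> ^ 2) \<le> C"
    using nnY \<open>C \<ge> 0\<close> by (subst (asm) nn_integral_eq_integral[OF intY]) auto
  have le1: "\<bar>y\<bar> \<le> 1 + y ^ 2" for y :: real
    using zero_le_power2[of "\<bar>y\<bar> - 1"] zero_le_power2[of y] unfolding power2_diff power2_abs by simp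
  have int1: "integrable M Y"
    using le1 intY by (intro Bochner_Integration.integrable_bound[of _ "\<lambda>\<omega>. 1 + Y \<omega> ^ 2" Y]) auto
  have intX: "integrable M (X i)" for i
    using le1 int by (intro Bochner_Integration.integrable_bound[of _ "\<lambda>\<omega>. 1 + X i \<omega> ^ 2" "X i"]) auto
  define D where "D i \<omega> = \<bar>X i \<omega> - Y \<omega>\<bar>" for i \<omega>
  have [measurable]: "random_variable borel (D i)" for i
    unfolding D_def by measurable
  have D2: "D i \<omega> ^ 2 \<le> 2 * X i \<omega> ^ 2 + 2 * Y \<omega> ^ 2" for i \<omega>
    using zero_le_power2[of "X i \<omega> + Y \<omega>"] unfolding D_def by (simp add: power2_eq_square algebra_simps)
  have intD2: "integrable M (\<lambda>\<omega>. D i \<omega> ^ 2)" for i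
    using D2[of i] int[of i] intY
    by (intro Bochner_Integration.integrable_bound[of _ "\<lambda>\<omega>. 2 * X i \<omega> ^ 2 + 2 * Y \<omega> ^ 2" "\<lambda>\<omega>. D i \<omega> ^ 2"]) auto
  have ED2: "expectation (\<lambda>\<omega>. D i \<omega> ^ 2) \<le> 4 * C" for i
  proof -
    have "expectation (\<lambda>\<omega>. D i \<omega> ^ 2) \<le> expectation (\<lambda>\<omega>. 2 * X i \<omega> ^ 2 + 2 * Y \<omega> ^ 2)"
      using D2[of i] int[of i] intY intD2 by (intro integral_mono) auto
    also have "\<dots> = 2 * expectation (\<lambda>\<omega>. X i \<omega> ^ 2) + 2 * expectation (\<lambda>\<omega>. Y \<omega> ^ 2)"
      using int[of i] intY by simp
    finally show ?thesis
      using bound[of i] boundY by simp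
  qed
  have intD: "integrable M (D i)" for i
    unfolding D_def using intX int1 by auto
  have intmin: "integrable M (\<lambda>\<omega>. min (D i \<omega>) R)" if "R \<ge> 0" for i R
    using that by (intro integrable_const_bound[of _ R]) (auto simp: D_def)
  have min_lim: "(\<lambda>i. expectation (\<lambda>\<omega>. min (D i \<omega>) R)) \<longlonglongrightarrow> 0" if "R \<ge> 0" for R
  proof -
    have "(\<lambda>i. expectation (\<lambda>\<omega>. min (D i \<omega>) R)) \<longlonglongrightarrow> expectation (\<lambda>\<omega>. 0)"
    proof (rule integral_dominated_convergence[where w = "\<lambda>_. R"])
      show "AE \<omega> in M. (\<lambda>i. min (D i \<omega>) R) \<longlonglongrightarrow> 0"
        using lim
      proof eventually_elim
        case (elim \<omega>)
        then have "(\<lambda>i. D i \<omega>) \<longlonglongrightarrow> 0"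
          unfolding D_def using LIM_zero tendsto_rabs_zero by blast
        then have "(\<lambda>i. min (D i \<omega>) R) \<longlonglongrightarrow> min 0 R"
          by (intro tendsto_min tendsto_const)
        then show ?case
          using that by simp
      qed
      show "AE \<omega> in M. norm (min (D i \<omega>) R) \<le> R" for i
        using that by (auto simp: D_def)
    qed auto
    then show ?thesis
      by simp
  qed
  have est: "\<bar>expectation (X i) - expectation Y\<bar> \<le> expectation (\<lambda>\<omega>. min (D i \<omega>) R) + 4 * C / R" if "R > 0" for i R
  proof -
    have le: "D i \<omega> \<le> min (D i \<omega>) R + D i \<omega> ^ 2 / R" for \<omega>
    proof (cases "D i \<omega> \<le> R")
      case False
      then have "D i \<omega> * R \<le> D i \<omega> * D i \<omega>"
        using that by (intro mult_left_mono) (auto simp: D_def)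
      then have "D i \<omega> \<le> D i \<omega> ^ 2 / R"
        using that by (simp add: pos_le_divide_eq power2_eq_square)
      then show ?thesis
        using False that by simp
    qed (use that in auto)
    have "\<bar>expectation (X i) - expectation Y\<bar> = \<bar>expectation (\<lambda>\<omega>. X i \<omega> - Y \<omega>)\<bar>"
      using intX int1 by simp
    also have "\<dots> \<le> expectation (D i)"
      unfolding D_def by (rule integral_abs_bound)
    also have "\<dots> \<le> expectation (\<lambda>\<omega>. min (D i \<omega>) R + D i \<omega> ^ 2 / R)"
      using intD intmin[of R] intD2 that le by (intro integral_mono) auto
    also have "\<dots> = expectation (\<lambda>\<omega>. min (D i \<omega>) R) + expectation (\<lambda>\<omega>. D i \<omega> ^ 2) / R"
      using intmin[of R] intD2 that by simp
    finally show ?thesis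
      using ED2[of i] that divide_right_mono[of "expectation (\<lambda>\<omega>. D i \<omega> ^ 2)" "4 * C" R] by simp
  qed
  show "(\<lambda>i. expectation (X i)) \<longlonglongrightarrow> expectation Y"
  proof (rule LIMSEQ_I)
    fix e :: real assume "e > 0"
    define R where "R = 8 * C / e + 1"
    have R: "R > 0" "4 * C / R < e / 2 + e / 4"
      using \<open>e > 0\<close> \<open>C \<ge> 0\<close> by (auto simp: R_def field_simps add_pos_nonneg intro!: add_nonneg_pos)
    obtain N where N: "\<And>i. i \<ge> N \<Longrightarrow> \<bar>expectation (\<lambda>\<omega>. min (D i \<omega>) R)\<bar> < e / 4"
      using LIMSEQ_D[OF min_lim[of R], of "e / 4"] R \<open>e > 0\<close> by auto
    have "norm (expectation (X i) - expectation Y) < e" if "i \<ge> N" for i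
      using est[OF R(1), of i] N[OF that] R(2) by simp
    then show "\<exists>N. \<forall>i\<ge>N. norm (expectation (X i) - expectation Y) < e"
      by blast
  qed
qed

text \<open>
  The moments of order \<open>2 n\<close> of the truncated differences are bounded uniformly in depth and time. This
  bound passes to the untruncated differences, and both times it gives convergence of the moments
  of order \<open>n\<close>: for growing depth at a fixed time, and then for growing time.
\<close>

lemma limit_moments:
  fixes W :: "'w \<Rightarrow> real"
  assumes p: "3/4 < p" "p \<le> 1" and urn: "two_type_urn M p clock mark"
    and W[measurable]: "W \<in> borel_measurable M"
    and lim: "AE \<omega> in M. ((\<lambda>t. (real (urn_count clock mark \<omega> t 1)
            - real (urn_count clock mark \<omega> t (-1))) / exp ((2 * p - 1) * t)) \<longlongrightarrow> W \<omega>) at_top"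
  shows "(\<integral>\<omega>. W \<omega> ^ 0 \<partial>M) = 1" "(\<integral>\<omega>. W \<omega> ^ 1 \<partial>M) = 1"
    and "(1 + real n * (2 * p - 1)) * (\<integral>\<omega>. W \<omega> ^ n \<partial>M) =
      branching_form (2 * p - 1) (\<lambda>n. \<integral>\<omega>. W \<omega> ^ n \<partial>M) n"
proof -
  interpret two_type_urn M p clock mark by fact
  define s where "s = 2 * p - 1"
  have s: "1/2 < s" "s \<le> 1"
    using p by (auto simp: s_def)
  obtain B where B: "\<And>n k t. 0 \<le> t \<Longrightarrow> \<bar>truncated_moment s k n t\<bar> \<le> B n"
    using truncated_moment_bounded[OF s] by metis
  \<comment> \<open>almost surely the scaled difference of the counts, but measurable by construction\<close>
  define Z where "Z t \<omega> = lim (\<lambda>k. scaled_difference s clock mark k t \<omega>)" for t \<omega>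
  have [measurable]: "Z t \<in> borel_measurable M" for t
    unfolding Z_def[abs_def] by measurable
  have Z: "AE \<omega> in M. \<forall>t. (\<lambda>k. scaled_difference s clock mark k t \<omega>) \<longlonglongrightarrow> Z t \<omega> \<and>
      Z t \<omega> = (real (urn_count clock mark \<omega> t 1) - real (urn_count clock mark \<omega> t (- 1))) / exp (s * t)"
    using AE_scaled_difference_eventually[of s]
  proof eventually_elim
    case (elim \<omega>)
    show ?case
    proof
      fix t
      let ?z = "(real (urn_count clock mark \<omega> t 1) - real (urn_count clock mark \<omega> t (- 1))) / exp (s * t)"
      have "(\<lambda>k. scaled_difference s clock mark k t \<omega>) \<longlonglongrightarrow> ?z"
        using elim by (intro tendsto_eventually) blast
      then show "(\<lambda>k. scaled_difference s clock mark k t \<omega>) \<longlonglongrightarrow> Z t \<omega> \<and> Z t \<omega> = ?z"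
        by (simp add: Z_def limI)
    qed
  qed
  note moment = expectation_scaled_difference_power[OF urn s_def]
  have trunc: "(\<lambda>k. truncated_moment s k n t) \<longlonglongrightarrow> expectation (\<lambda>\<omega>. Z t \<omega> ^ n)"
    "integrable M (\<lambda>\<omega>. (Z t \<omega> ^ n) ^ 2)" "expectation (\<lambda>\<omega>. (Z t \<omega> ^ n) ^ 2) \<le> B (n * 2)" if "0 \<le> t" for n t
  proof -
    have 1: "random_variable borel (\<lambda>\<omega>. scaled_difference s clock mark k t \<omega> ^ n)" for k
      by measurable
    have 2: "random_variable borel (\<lambda>\<omega>. Z t \<omega> ^ n)"
      by measurable
    have 3: "AE \<omega> in M. (\<lambda>k. scaled_difference s clock mark k t \<omega> ^ n) \<longlonglongrightarrow> Z t \<omega> ^ n"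
      using Z by eventually_elim (intro tendsto_power, blast)
    have 4: "integrable M (\<lambda>\<omega>. (scaled_difference s clock mark k t \<omega> ^ n) ^ 2)" for k
      using integrable_scaled_difference_power[of s t k "n * 2"] s that by (simp add: power_mult)
    have 5: "expectation (\<lambda>\<omega>. (scaled_difference s clock mark k t \<omega> ^ n) ^ 2) \<le> B (n * 2)" for k
      using moment[of t k "n * 2"] B[OF that, of k "n * 2"] s that by (simp add: power_mult)
    note UI = expectation_tendsto_of_second_moments[OF 1 2 3 4 5]
    show "(\<lambda>k. truncated_moment s k n t) \<longlonglongrightarrow> expectation (\<lambda>\<omega>. Z t \<omega> ^ n)"
      using UI(1) moment[of t _ n] s that by simp
    show "integrable M (\<lambda>\<omega>. (Z t \<omega> ^ n) ^ 2)" "expectation (\<lambda>\<omega>. (Z t \<omega> ^ n) ^ 2) \<le> B (n * 2)"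
      by (fact UI(2), fact UI(3))
  qed
  have time: "((\<lambda>t. expectation (\<lambda>\<omega>. Z t \<omega> ^ n)) \<longlongrightarrow> expectation (\<lambda>\<omega>. W \<omega> ^ n)) at_top" for n
  proof (rule tendsto_at_topI_sequentially)
    fix X :: "nat \<Rightarrow> real" assume X: "filterlim X at_top sequentially"
    \<comment> \<open>the moment bounds hold at nonnegative times only\<close>
    define Y where "Y i = max 0 (X i)" for i
    have ev: "\<forall>\<^sub>F i in sequentially. X i = Y i"
      using X unfolding filterlim_at_top Y_def by (auto elim: eventually_mono dest!: spec[of _ 0])
    have "filterlim Y at_top sequentially"
      using X ev by (rule filterlim_mono_eventually[OF _ order_refl order_refl])
    have 1: "random_variable borel (\<lambda>\<omega>. Z (Y i) \<omega> ^ n)" for i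
      by measurable
    have 2: "random_variable borel (\<lambda>\<omega>. W \<omega> ^ n)"
      by measurable
    have 3: "AE \<omega> in M. (\<lambda>i. Z (Y i) \<omega> ^ n) \<longlonglongrightarrow> W \<omega> ^ n"
      using Z lim[folded s_def]
    proof eventually_elim
      case (elim \<omega>)
      then have "((\<lambda>t. Z t \<omega>) \<longlongrightarrow> W \<omega>) at_top"
        by simp
      then show ?case
        using \<open>filterlim Y at_top sequentially\<close> by (intro tendsto_power) (rule filterlim_compose)
    qed
    have "0 \<le> Y i" for i
      by (simp add: Y_def)
    then have "(\<lambda>i. expectation (\<lambda>\<omega>. Z (Y i) \<omega> ^ n)) \<longlonglongrightarrow> expectation (\<lambda>\<omega>. W \<omega> ^ n)"
      by (intro expectation_tendsto_of_second_moments(1)[OF 1 2 3 trunc(2) trunc(3)])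
    then show "(\<lambda>i. expectation (\<lambda>\<omega>. Z (X i) \<omega> ^ n)) \<longlonglongrightarrow> expectation (\<lambda>\<omega>. W \<omega> ^ n)"
      by (rule Lim_transform_eventually) (use ev in eventually_elim, simp)
  qed
  show "(\<integral>\<omega>. W \<omega> ^ 0 \<partial>M) = 1"
    by (simp add: prob_space)
  have "expectation (\<lambda>\<omega>. Z t \<omega> ^ 1) = 1" if "0 \<le> t" for t
    using trunc(1)[OF that, of 1] truncated_moment_n1_tendsto[of s t] s that
    by (intro LIMSEQ_unique) auto
  then have "((\<lambda>t. expectation (\<lambda>\<omega>. Z t \<omega> ^ 1)) \<longlongrightarrow> 1) at_top"
    by (intro tendsto_eventually) (auto simp: eventually_at_top_linorder)
  with time[of 1] show "(\<integral>\<omega>. W \<omega> ^ 1 \<partial>M) = 1"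
    by (rule tendsto_unique[rotated]) simp
  show "(1 + real n * (2 * p - 1)) * (\<integral>\<omega>. W \<omega> ^ n \<partial>M) =
      branching_form (2 * p - 1) (\<lambda>n. \<integral>\<omega>. W \<omega> ^ n \<partial>M) n"
    using limit_moment_recursion[OF _ B trunc(1) time] s unfolding s_def by simp
qed

theorem corollary2p5:
  fixes M :: "'w measure" and p :: real
    and clock mark :: "nat list \<times> nat \<Rightarrow> 'w \<Rightarrow> real"
    and W\<^sub>1 :: "'w \<Rightarrow> real" and r :: "nat \<Rightarrow> real"
  assumes p: "3/4 < p" "p < 1"
    and urn: "two_type_urn M p clock mark"
    and W1_measurable: "W\<^sub>1 \<in> borel_measurable M"
    and W1_limit: "AE \<omega> in M. ((\<lambda>t. (real (urn_count clock mark \<omega> t 1)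
            - real (urn_count clock mark \<omega> t (-1))) / exp ((2 * p - 1) * t)) \<longlongrightarrow> W\<^sub>1 \<omega>) at_top"
    and r: "\<And>n. r n = (\<integral>\<omega>. W\<^sub>1 \<omega> ^ n \<partial>M)"
  shows "r 1 = 1 \<and>
    (\<forall>n\<ge>1. odd n \<longrightarrow>
       (real (n + 1) * (2 * p - 1) - 1) * r (n + 1) =
         2 * (\<Sum>i = 1..(n - 1) div 2. real (n choose (2 * i - 1)) * r (2 * i) * r (n + 1 - 2 * i))
       + 2 * (2 * p - 1) * (\<Sum>i = 1..(n + 1) div 2.
           real (n choose (2 * i - 1)) * r (2 * i - 1) * r (n + 2 - 2 * i))) \<and>
    (\<forall>n\<ge>1. even n \<longrightarrow>
       real n * (2 * p - 1) * r (n + 1) =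
         2 * p * (\<Sum>i = 1..n div 2.
           (real (n choose (2 * i - 1)) + real (n choose (2 * i))) * r (2 * i) * r (n + 1 - 2 * i)))"
proof -
  have "r = (\<lambda>n. \<integral>\<omega>. W\<^sub>1 \<omega> ^ n \<partial>M)"
    using r by auto
  then have r01: "r 0 = 1" "r 1 = 1"
    and rec: "(1 + real n * (2 * p - 1)) * r n = branching_form (2 * p - 1) r n" for n
    using limit_moments[OF p(1) less_imp_le[OF p(2)] urn W1_measurable W1_limit] by simp_all
  show ?thesis
    using r01(2) branching_recursion_odd_index[OF rec r01(1)] branching_recursion_even_index[OF rec r01(1)]
    by (intro conjI allI impI) auto
qed

end
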